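(* Let $a\ge 0$, $p>1$ and $N\ge 3$. If $$1<p<\frac{N+2+2a}{N-2},$$ then the equation $$-\Delta u=|x|^{a}u^{p}\quad\text{in }\mathbb{R}^N$$ has no positive solution with finite Morse index.
   Context: Solutions are classical ($C^2$). For a positive solution $u$ of $-\Delta u=|x|^a u^p$ in $\mathbb{R}^N$ and $\phi\in C^1_c(\mathbb{R}^N)$ set $$I_{uu}(\phi):=\int_{\mathbb{R}^N}|\nabla\phi|^2\,dx-p\int_{\mathbb{R}^N}|x|^a u^{p-1}\phi^2\,dx .$$ The solution $u$ is called stable if $I_{uu}(\phi)\ge 0$ for all $\phi\in C_c^1(\mathbb{R}^N)$ (Morse index $0$). It has Morse index equal to $m\ge1$ if $m$ is the maximal dimension of a linear subspace $X_m\subset C_c^1(\mathbb{R}^N)$ such that $I_{uu}(\phi)<0$ for all $\phi\in X_m\setminus\{0\}$. It has finite Morse index if it is stable or has Morse index equal to some integer $m\ge 1$. *)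

theory Defs
  imports "HOL-Analysis.Analysis" "HOL-Library.Function_Algebras"
begin

definition partial_deriv :: "'n::finite \<Rightarrow> (real ^ 'n \<Rightarrow> real) \<Rightarrow> real ^ 'n \<Rightarrow> real" where
  "partial_deriv i f x = frechet_derivative f (at x) (axis i 1)"

definition grad :: "(real ^ 'n::finite \<Rightarrow> real) \<Rightarrow> real ^ 'n \<Rightarrow> real ^ 'n" where
  "grad f x = (\<chi> i. partial_deriv i f x)"

definition laplacian :: "(real ^ 'n::finite \<Rightarrow> real) \<Rightarrow> real ^ 'n \<Rightarrow> real" where
  "laplacian f x = (\<Sum>i\<in>UNIV. partial_deriv i (partial_deriv i f) x)"

definition C1 :: "(real ^ 'n::finite \<Rightarrow> real) set" where
  "C1 = {f. (\<forall>x. f differentiable (at x)) \<and> (\<forall>i. continuous_on UNIV (partial_deriv i f))}"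

definition C2 :: "(real ^ 'n::finite \<Rightarrow> real) set" where
  "C2 = {f \<in> C1. \<forall>i. partial_deriv i f \<in> C1}"

definition C1c :: "(real ^ 'n::finite \<Rightarrow> real) set" where
  "C1c = {\<phi> \<in> C1. compact (closure {x. \<phi> x \<noteq> 0})}"

text \<open>
  The weight \<open>|x|\<^sup>a\<close> for \<open>a \<ge> 0\<close>. The case distinction is needed because \<open>0 powr 0 = 0\<close> in
  Isabelle/HOL, whereas \<open>|x|\<^sup>0\<close> is the constant \<open>1\<close>, also at the origin.
\<close>

definition norm_pow :: "real \<Rightarrow> real ^ 'n::finite \<Rightarrow> real" where
  "norm_pow a x = (if a = 0 then 1 else norm x powr a)"

definition positive_solution :: "real \<Rightarrow> real \<Rightarrow> (real ^ 'n::finite \<Rightarrow> real) \<Rightarrow> bool" where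
  "positive_solution a p u \<longleftrightarrow>
     u \<in> C2 \<and> (\<forall>x. u x > 0) \<and> (\<forall>x. - laplacian u x = norm_pow a x * u x powr p)"

definition I_uu :: "real \<Rightarrow> real \<Rightarrow> (real ^ 'n::finite \<Rightarrow> real) \<Rightarrow> (real ^ 'n \<Rightarrow> real) \<Rightarrow> real" where
  "I_uu a p u \<phi> =
     (LINT x|lborel. (norm (grad \<phi> x))\<^sup>2)
     - p * (LINT x|lborel. norm_pow a x * u x powr (p - 1) * (\<phi> x)\<^sup>2)"

definition stable :: "real \<Rightarrow> real \<Rightarrow> (real ^ 'n::finite \<Rightarrow> real) \<Rightarrow> bool" where
  "stable a p u \<longleftrightarrow> (\<forall>\<phi>\<in>C1c. I_uu a p u \<phi> \<ge> 0)"

definition fun_scale :: "real \<Rightarrow> ('b \<Rightarrow> real) \<Rightarrow> 'b \<Rightarrow> real" where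
  "fun_scale c f = (\<lambda>x. c * f x)"

global_interpretation fun_space: vector_space "fun_scale :: real \<Rightarrow> ('b \<Rightarrow> real) \<Rightarrow> 'b \<Rightarrow> real"
  by standard (auto simp: fun_scale_def fun_eq_iff algebra_simps)

text \<open>
  The locale constant \<open>dim\<close> returns a junk value on infinite-dimensional spaces, so being of
  finite dimension \<open>k\<close> is expressed through a finite basis.
\<close>

definition has_finite_dim :: "('b \<Rightarrow> real) set \<Rightarrow> nat \<Rightarrow> bool" where
  "has_finite_dim X k \<longleftrightarrow>
     (\<exists>B. finite B \<and> card B = k \<and> fun_space.independent B \<and> fun_space.span B = X)"

definition negative_subspace ::
  "real \<Rightarrow> real \<Rightarrow> (real ^ 'n::finite \<Rightarrow> real) \<Rightarrow> (real ^ 'n \<Rightarrow> real) set \<Rightarrow> bool" where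
  "negative_subspace a p u X \<longleftrightarrow>
     fun_space.subspace X \<and> X \<subseteq> C1c \<and> (\<forall>\<phi>\<in>X - {0}. I_uu a p u \<phi> < 0)"

text \<open>
  The second conjunct also excludes infinite-dimensional negative subspaces: \<open>m\<close> bounds the
  dimension of every negative subspace.
\<close>

definition has_morse_index :: "real \<Rightarrow> real \<Rightarrow> (real ^ 'n::finite \<Rightarrow> real) \<Rightarrow> nat \<Rightarrow> bool" where
  "has_morse_index a p u m \<longleftrightarrow>
     (\<exists>X. negative_subspace a p u X \<and> has_finite_dim X m) \<and>
     (\<forall>X. negative_subspace a p u X \<longrightarrow> (\<exists>k\<le>m. has_finite_dim X k))"

definition finite_morse_index :: "real \<Rightarrow> real \<Rightarrow> (real ^ 'n::finite \<Rightarrow> real) \<Rightarrow> bool" where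
  "finite_morse_index a p u \<longleftrightarrow> stable a p u \<or> (\<exists>m\<ge>1. has_morse_index a p u m)"

end

theory Submission
  imports Defs
begin

text \<open>
  Write \<open>w = |x|\<^sup>a\<close> and \<open>E = w u\<^bsup>p+1\<^esup>\<close>. The theorem follows from two facts about a positive
  solution \<open>u\<close> that pull in opposite directions.

  The first is an identity of Pohozaev type. The vector field
  \<open>V = (x \<bullet> \<nabla>u) \<nabla>u - x |\<nabla>u|\<^sup>2 / 2 + x E / (p+1) + (N-2)/2 u \<nabla>u\<close> has divergence \<open>\<delta> E\<close> with the
  constant \<open>\<delta> = (N+a)/(p+1) - (N-2)/2\<close>, and \<open>\<delta> > 0\<close> says exactly that \<open>p\<close> is subcritical. Tested
  with a cutoff \<open>\<eta>\<close> that equals \<open>1\<close> on the ball of radius \<open>R\<close> and vanishes outside the ball of radius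
  \<open>2R\<close>, it bounds \<open>\<delta> \<integral> \<eta> E\<close> by a multiple of the integral of \<open>E + |\<nabla>u|\<^sup>2 + u\<^sup>2/R\<^sup>2\<close> over the annulus
  \<open>R \<le> |x| \<le> 2R\<close> (\<open>pohozaev_identity\<close>).

  The second is that this annular integral tends to \<open>0\<close> (\<open>annulus_energy_decay\<close>). A solution of
  finite Morse index is stable outside a ball, because a direction of instability supported far away
  could be added to a negative subspace of maximal dimension
  (\<open>finite_morse_index_imp_stable_outside\<close>). Stability tested with \<open>u \<eta>\<close>, combined with the equation
  tested with \<open>u \<eta>\<^sup>2\<close>, gives \<open>(p-1) \<integral> E \<eta>\<^sup>2 \<le> \<integral> u\<^sup>2 |\<nabla>\<eta>|\<^sup>2\<close> (\<open>stability_inequality\<close>). If \<open>\<eta>\<close> is a high power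
  of a cutoff to the annulus, Young's inequality absorbs the right hand side up to a remainder of order
  \<open>R\<^bsup>N-2-2(2+a)/(p-1)\<^esup>\<close>. The exponent is negative exactly when \<open>p\<close> is subcritical.

  Hence \<open>\<integral> \<eta> E \<rightarrow> 0\<close> as \<open>R \<rightarrow> \<infinity>\<close>, which is impossible for \<open>u > 0\<close>.
\<close>

section \<open>Continuously differentiable functions and their gradients\<close>

text \<open>
  The gradient is a parameter here, so that gradients of sums, products and compositions can be
  computed by applying rules.
\<close>

definition C1_grad :: "(real ^ 'n::finite \<Rightarrow> real) \<Rightarrow> (real ^ 'n \<Rightarrow> real ^ 'n) \<Rightarrow> bool" where
  "C1_grad f G \<longleftrightarrow>
     continuous_on UNIV G \<and> (\<forall>x. (f has_derivative (\<lambda>h. G x \<bullet> h)) (at x))"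

lemma C1_gradI:
  assumes "continuous_on UNIV G" "\<And>x. (f has_derivative (\<lambda>h. G x \<bullet> h)) (at x)"
  shows "C1_grad f G"
  using assms by (simp add: C1_grad_def)

lemma C1_gradD:
  assumes "C1_grad f G"
  shows "continuous_on UNIV G" "(f has_derivative (\<lambda>h. G x \<bullet> h)) (at x)"
  using assms by (simp_all add: C1_grad_def)

lemma C1_grad_continuous: "C1_grad f G \<Longrightarrow> continuous_on UNIV f"
  by (meson C1_gradD(2) has_derivative_continuous_on has_derivative_at_withinI)

lemma C1_grad_partial_deriv:
  assumes "C1_grad f G"
  shows "partial_deriv i f x = G x $ i"
  unfolding partial_deriv_def frechet_derivative_at[OF C1_gradD(2)[OF assms], symmetric]
  by (simp add: inner_axis)

lemma C1_grad_grad: "C1_grad f G \<Longrightarrow> grad f = G"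
  by (simp add: grad_def fun_eq_iff vec_eq_iff C1_grad_partial_deriv)

lemma C1_grad_imp_C1:
  assumes "C1_grad f G" shows "f \<in> C1"
proof -
  have "partial_deriv i f = (\<lambda>x. G x $ i)" for i
    by (simp add: fun_eq_iff C1_grad_partial_deriv[OF assms])
  moreover have "continuous_on UNIV (\<lambda>x. G x $ i)" for i
    by (intro continuous_intros C1_gradD(1)[OF assms])
  ultimately show ?thesis
    unfolding C1_def using C1_gradD(2)[OF assms] by (auto simp: differentiable_def)
qed

lemma C1_grad_of_C1:
  fixes f :: "real ^ 'n::finite \<Rightarrow> real"
  assumes "f \<in> C1" shows "C1_grad f (grad f)"
proof (rule C1_gradI)
  show "continuous_on UNIV (grad f)"
    unfolding grad_def using assms by (intro continuous_intros) (auto simp: C1_def)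
  fix x
  have d: "(f has_derivative frechet_derivative f (at x)) (at x)"
    using assms by (simp add: C1_def frechet_derivative_works[symmetric])
  interpret linear "frechet_derivative f (at x)"
    by (rule linear_frechet_derivative) (use assms in \<open>simp add: C1_def\<close>)
  have "frechet_derivative f (at x) h = grad f x \<bullet> h" for h
  proof -
    have "frechet_derivative f (at x) h = frechet_derivative f (at x) (\<Sum>i\<in>UNIV. h $ i *\<^sub>R axis i 1)"
      by (subst basis_expansion[of h, symmetric]) (simp add: scalar_mult_eq_scaleR)
    also have "\<dots> = (\<Sum>i\<in>UNIV. h $ i * grad f x $ i)"
      by (simp add: sum scale grad_def partial_deriv_def)
    finally show ?thesis by (simp add: inner_vec_def mult.commute)
  qed
  then show "(f has_derivative (\<lambda>h. grad f x \<bullet> h)) (at x)"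
    using d by (metis (no_types, lifting) ext)
qed

lemma C1_grad_mult:
  assumes "C1_grad f F" "C1_grad g G"
  shows "C1_grad (\<lambda>x. f x * g x) (\<lambda>x. f x *\<^sub>R G x + g x *\<^sub>R F x)"
proof (rule C1_gradI)
  show "continuous_on UNIV (\<lambda>x. f x *\<^sub>R G x + g x *\<^sub>R F x)"
    by (intro continuous_intros C1_grad_continuous[OF assms(1)] C1_grad_continuous[OF assms(2)]
        C1_gradD(1)[OF assms(1)] C1_gradD(1)[OF assms(2)])
  show "((\<lambda>x. f x * g x) has_derivative (\<lambda>h. (f x *\<^sub>R G x + g x *\<^sub>R F x) \<bullet> h)) (at x)" for x
    by (rule has_derivative_eq_rhs[OF has_derivative_mult[OF C1_gradD(2)[OF assms(1)] C1_gradD(2)[OF assms(2)]]])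
       (simp add: algebra_simps fun_eq_iff)
qed

lemma C1_grad_add:
  assumes "C1_grad f F" "C1_grad g G"
  shows "C1_grad (\<lambda>x. f x + g x) (\<lambda>x. F x + G x)"
proof (rule C1_gradI)
  show "continuous_on UNIV (\<lambda>x. F x + G x)"
    by (intro continuous_intros C1_gradD(1)[OF assms(1)] C1_gradD(1)[OF assms(2)])
  show "((\<lambda>x. f x + g x) has_derivative (\<lambda>h. (F x + G x) \<bullet> h)) (at x)" for x
    by (rule has_derivative_eq_rhs[OF has_derivative_add[OF C1_gradD(2)[OF assms(1)] C1_gradD(2)[OF assms(2)]]])
       (simp add: algebra_simps fun_eq_iff)
qed

lemma C1_grad_const: "C1_grad (\<lambda>x. c) (\<lambda>x. 0)"
  by (rule C1_gradI) auto

lemma C1_grad_cmult: "C1_grad f F \<Longrightarrow> C1_grad (\<lambda>x. c * f x) (\<lambda>x. c *\<^sub>R F x)"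
  using C1_grad_mult[OF C1_grad_const[of c]] by simp

lemma C1_grad_diff:
  assumes "C1_grad f F" "C1_grad g G"
  shows "C1_grad (\<lambda>x. f x - g x) (\<lambda>x. F x - G x)"
  using C1_grad_add[OF assms(1) C1_grad_cmult[OF assms(2), of "-1"]] by simp

lemma C1_grad_sum:
  assumes "finite A" "\<And>i. i \<in> A \<Longrightarrow> C1_grad (f i) (F i)"
  shows "C1_grad (\<lambda>x. \<Sum>i\<in>A. f i x) (\<lambda>x. \<Sum>i\<in>A. F i x)"
  using assms by (induction A rule: finite_induct) (auto intro: C1_grad_const C1_grad_add)

lemma C1_grad_component: "C1_grad (\<lambda>x. x $ i) (\<lambda>x. axis i 1)"
  by (rule C1_gradI)
     (simp_all add: inner_axis' bounded_linear_imp_has_derivative bounded_linear_vec_nth)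

lemma C1_grad_compose:
  assumes f: "C1_grad f F"
    and der: "\<And>x. (\<phi> has_real_derivative \<phi>' (f x)) (at (f x))"
    and cont: "continuous_on UNIV (\<lambda>x. \<phi>' (f x))"
  shows "C1_grad (\<lambda>x. \<phi> (f x)) (\<lambda>x. \<phi>' (f x) *\<^sub>R F x)"
proof (rule C1_gradI)
  show "continuous_on UNIV (\<lambda>x. \<phi>' (f x) *\<^sub>R F x)"
    by (intro continuous_intros cont C1_gradD(1)[OF f])
  show "((\<lambda>x. \<phi> (f x)) has_derivative (\<lambda>h. (\<phi>' (f x) *\<^sub>R F x) \<bullet> h)) (at x)" for x
    using has_derivative_compose[OF C1_gradD(2)[OF f, of x] der[of x, unfolded has_field_derivative_def]]
    by simp
qed

lemma C1_grad_eq_0: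
  assumes f: "C1_grad f F" and "open S" "x \<in> S" and "\<And>y. y \<in> S \<Longrightarrow> f y = 0"
  shows "F x = 0"
proof -
  have "(f has_derivative (\<lambda>h. F x \<bullet> h)) (at x)" by (rule C1_gradD(2)[OF f])
  moreover have "(f has_derivative (\<lambda>h. 0)) (at x)"
    by (rule has_derivative_transform_within_open[OF has_derivative_const \<open>open S\<close> \<open>x \<in> S\<close>])
       (use assms in auto)
  ultimately have "(\<lambda>h. F x \<bullet> h) = (\<lambda>h. 0)" by (rule has_derivative_unique)
  then have "F x \<bullet> F x = 0" by metis
  then show ?thesis by simp
qed

lemma C1_grad_eq_0_outside:
  assumes "C1_grad f F" "\<And>x. r < norm x \<Longrightarrow> f x = 0" "r < norm x"
  shows "F x = 0"
proof (rule C1_grad_eq_0[OF assms(1), of "- cball 0 r"])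
  show "open (- cball (0::real^'a) r)" by (simp add: open_Compl)
qed (use assms in auto)

lemma C1c_iff:
  "f \<in> C1c \<longleftrightarrow> f \<in> C1 \<and> (\<exists>r. \<forall>x. r < norm x \<longrightarrow> f x = 0)" for f :: "real ^ 'n::finite \<Rightarrow> real"
proof -
  have "compact (closure {x. f x \<noteq> 0}) \<longleftrightarrow> bounded {x. f x \<noteq> 0}"
    by simp
  also have "\<dots> \<longleftrightarrow> (\<exists>r. \<forall>x. r < norm x \<longrightarrow> f x = 0)"
    unfolding bounded_iff using linorder_not_le by blast
  finally show ?thesis by (auto simp: C1c_def)
qed

lemma integrable_compactly_supported:
  fixes f :: "real ^ 'n::finite \<Rightarrow> real"
  assumes "continuous_on UNIV f" "\<And>x. r < norm x \<Longrightarrow> f x = 0"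
  shows "integrable lborel f"
proof -
  have "integrable lborel (\<lambda>x. indicator (cball 0 r) x *\<^sub>R f x)"
    by (rule borel_integrable_compact) (auto intro: continuous_on_subset[OF assms(1)])
  moreover have "(\<lambda>x. indicator (cball 0 r) x *\<^sub>R f x) = f"
    using assms(2) by (force simp: indicator_def fun_eq_iff)
  ultimately show ?thesis by simp
qed

section \<open>Integration by parts\<close>

text \<open>
  The integrals of the translates of \<open>f\<close> all agree, so difference quotients of \<open>f\<close> have integral \<open>0\<close>.
  They are uniformly bounded with support in a fixed ball, and dominated convergence applies.
\<close>

lemma integral_partial_deriv_eq_0:
  fixes f :: "real ^ 'n::finite \<Rightarrow> real"
  assumes f: "C1_grad f G" and supp: "\<And>x. r < norm x \<Longrightarrow> f x = 0"
  shows "(LINT x|lborel. G x $ i) = 0"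
proof -
  define e :: "real ^ 'n" where "e = axis i 1"
  define h :: "nat \<Rightarrow> real" where "h n = 1 / real (Suc n)" for n
  define D where "D n x = (f (x + h n *\<^sub>R e) - f x) / h n" for n x
  have h: "0 < h n" "h n \<le> 1" for n by (auto simp: h_def)
  have h0: "h \<longlonglongrightarrow> 0" unfolding h_def by (rule LIMSEQ_Suc[OF lim_1_over_n])
  have cf: "continuous_on UNIV f" by (rule C1_grad_continuous[OF f])
  have mf: "f \<in> borel_measurable lborel" using borel_measurable_continuous_onI[OF cf] by simp
  have mG: "(\<lambda>x. G x $ i) \<in> borel_measurable lborel"
    using borel_measurable_continuous_onI[of "\<lambda>x. G x $ i"] C1_gradD(1)[OF f]
    by (simp add: continuous_on_component)
  have If: "integrable lborel f" by (rule integrable_compactly_supported[OF cf supp])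
  have It: "integrable lborel (\<lambda>x. f (x + c))" "(LINT x|lborel. f (x + c)) = (LINT x|lborel. f x)" for c
  proof -
    have "integrable (distr lborel borel ((+) c)) f" using If by (simp add: lborel_distr_plus)
    then show "integrable lborel (\<lambda>x. f (x + c))"
      by (subst (asm) integrable_distr_eq) (use mf in \<open>auto simp: add.commute\<close>)
    have "(LINT x|lborel. f x) = integral\<^sup>L (distr lborel borel ((+) c)) f"
      by (simp add: lborel_distr_plus)
    also have "\<dots> = (LINT x|lborel. f (x + c))"
      by (subst integral_distr) (use mf in \<open>auto simp: add.commute\<close>)
    finally show "(LINT x|lborel. f (x + c)) = (LINT x|lborel. f x)" by simp
  qed
  have D0: "integral\<^sup>L lborel (D n) = 0" for n
    unfolding D_def using It[of "h n *\<^sub>R e"] If by simp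
  have ID: "integrable lborel (D n)" for n
    unfolding D_def using It[of "h n *\<^sub>R e"] If by simp
  obtain B where B: "\<And>x. x \<in> cball 0 (r + 2) \<Longrightarrow> norm (G x) \<le> B"
  proof -
    have "compact (G ` cball 0 (r + 2))"
      by (intro compact_continuous_image continuous_on_subset[OF C1_gradD(1)[OF f]]) auto
    then obtain B where "\<forall>y\<in>G ` cball 0 (r + 2). norm y \<le> B"
      using compact_imp_bounded bounded_iff by metis
    then show ?thesis using that by blast
  qed
  have on: "onorm (\<lambda>h. G y \<bullet> h) \<le> B" if "norm y \<le> r + 2" for y
  proof (rule onorm_le)
    fix h
    have "norm (G y \<bullet> h) \<le> norm (G y) * norm h" by (simp add: Cauchy_Schwarz_ineq2)
    also have "\<dots> \<le> B * norm h" by (intro mult_right_mono B) (use that in auto)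
    finally show "norm (G y \<bullet> h) \<le> B * norm h" .
  qed
  have "(\<lambda>n. integral\<^sup>L lborel (D n)) \<longlonglongrightarrow> (LINT x|lborel. G x $ i)"
  proof (rule integral_dominated_convergence)
    show "integrable lborel (\<lambda>x. B * indicator (cball (0::real^'n) (r + 1)) x)"
      by (intro integrable_mult_right integrable_real_indicator)
         (use emeasure_lborel_cball_finite[of "0::real^'n" "r+1"] in \<open>auto simp: less_top\<close>)
    show "AE x in lborel. (\<lambda>n. D n x) \<longlonglongrightarrow> G x $ i"
    proof (rule AE_I2)
      fix x :: "real ^ 'n"
      have "((\<lambda>t. f (x + t *\<^sub>R e)) has_derivative (\<lambda>t. G x \<bullet> (t *\<^sub>R e))) (at 0)"
        by (rule has_derivative_compose[where f="\<lambda>t. x + t *\<^sub>R e" and g=f])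
           (auto intro!: derivative_eq_intros C1_gradD(2)[OF f])
      then have "((\<lambda>t. f (x + t *\<^sub>R e)) has_real_derivative G x $ i) (at 0)"
        by (simp add: has_field_derivative_def e_def inner_axis mult_commute_abs)
      then have "((\<lambda>t. (f (x + t *\<^sub>R e) - f x) / t) \<longlongrightarrow> G x $ i) (at 0)"
        by (simp add: DERIV_def)
      then show "(\<lambda>n. D n x) \<longlonglongrightarrow> G x $ i"
        unfolding D_def
        by (rule filterlim_compose)
           (use h h0 in \<open>auto simp: filterlim_at intro!: eventuallyI less_imp_neq[symmetric]\<close>)
    qed
    show "AE x in lborel. norm (D n x) \<le> B * indicator (cball 0 (r + 1)) x" for n
    proof (rule AE_I2)
      fix x :: "real ^ 'n"
      have nhe: "norm (h n *\<^sub>R e) = h n" using h(1)[of n] by (simp add: e_def)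
      show "norm (D n x) \<le> B * indicator (cball 0 (r + 1)) x"
      proof (cases "norm x \<le> r + 1")
        case True
        have "norm (x + h n *\<^sub>R e) \<le> r + 2"
          using True norm_triangle_ineq[of x "h n *\<^sub>R e"] h(2)[of n] nhe by linarith
        then have "norm (f (x + h n *\<^sub>R e) - f x) \<le> B * norm (x + h n *\<^sub>R e - x)"
          using True
          by (intro differentiable_bound[of "cball 0 (r + 2)" f "\<lambda>x h. G x \<bullet> h"])
             (auto intro!: has_derivative_at_withinI C1_gradD(2)[OF f] on)
        then show ?thesis
          using h(1)[of n] nhe True by (simp add: D_def field_simps)
      next
        case False
        have "r < norm (x + h n *\<^sub>R e)"
          using False norm_triangle_ineq4[of "x + h n *\<^sub>R e" "h n *\<^sub>R e"] h(2)[of n] nhe by simp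
        then show ?thesis using False supp by (simp add: D_def)
      qed
    qed
    show "D n \<in> borel_measurable lborel" for n using ID by simp
  qed (rule mG)
  then show ?thesis using D0 by (simp add: LIMSEQ_const_iff)
qed

lemma integral_by_parts_div:
  fixes \<eta> :: "real ^ 'n::finite \<Rightarrow> real" and V :: "'n \<Rightarrow> real ^ 'n \<Rightarrow> real"
  assumes \<eta>: "C1_grad \<eta> G" and supp: "\<And>x. r < norm x \<Longrightarrow> \<eta> x = 0"
    and V: "\<And>i. C1_grad (V i) (DV i)"
  shows "(LINT x|lborel. \<eta> x * (\<Sum>i\<in>UNIV. DV i x $ i)) = - (LINT x|lborel. (\<Sum>i\<in>UNIV. G x $ i * V i x))"
proof -
  have G0: "G x = 0" if "r < norm x" for x by (rule C1_grad_eq_0_outside[OF \<eta> supp that])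
  have I1: "integrable lborel (\<lambda>x. \<eta> x * DV i x $ i)" for i
    by (rule integrable_compactly_supported[where r=r])
       (auto simp: supp intro!: continuous_intros C1_grad_continuous[OF \<eta>] C1_gradD(1)[OF V])
  have I2: "integrable lborel (\<lambda>x. G x $ i * V i x)" for i
    by (rule integrable_compactly_supported[where r=r])
       (auto simp: G0 intro!: continuous_intros C1_grad_continuous[OF V] C1_gradD(1)[OF \<eta>])
  have "(LINT x|lborel. \<eta> x * DV i x $ i) = - (LINT x|lborel. G x $ i * V i x)" for i
  proof -
    have "(LINT x|lborel. (\<eta> x *\<^sub>R DV i x + V i x *\<^sub>R G x) $ i) = 0"
      by (rule integral_partial_deriv_eq_0[OF C1_grad_mult[OF \<eta> V], where r=r]) (simp add: supp)
    then have "(LINT x|lborel. \<eta> x * DV i x $ i + G x $ i * V i x) = 0"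
      by (simp add: mult.commute)
    then show ?thesis using I1 I2 by simp
  qed
  then show ?thesis
    using I1 I2 by (simp add: sum_distrib_left sum_negf[symmetric])
qed

section \<open>Symmetry of second derivatives\<close>

text \<open>
  The mean value theorem is applied twice: along \<open>i\<close> to the increment of \<open>f\<close> in direction \<open>j\<close>, then
  along \<open>j\<close> to the partial derivative in direction \<open>i\<close>.
\<close>

lemma mixed_difference_quotient:
  fixes f :: "real ^ 'n::finite \<Rightarrow> real"
  assumes f: "C1_grad f F" and Fi: "C1_grad (\<lambda>x. F x $ i) Hi" and h: "0 < h"
  shows "\<exists>s t. 0 < s \<and> s < h \<and> 0 < t \<and> t < h \<and>
    (f (x + h *\<^sub>R axis i 1 + h *\<^sub>R axis j 1) - f (x + h *\<^sub>R axis i 1) - f (x + h *\<^sub>R axis j 1) + f x) / h\<^sup>2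
      = Hi (x + s *\<^sub>R axis i 1 + t *\<^sub>R axis j 1) $ j"
proof -
  define e where "e k = (axis k 1 :: real ^ 'n)" for k
  have d: "((\<lambda>t. g (y + t *\<^sub>R e k)) has_real_derivative G (y + t *\<^sub>R e k) $ k) (at t)"
    if "C1_grad g G" for g G y k t
  proof -
    have "((\<lambda>t. g (y + t *\<^sub>R e k)) has_derivative (\<lambda>s. G (y + t *\<^sub>R e k) \<bullet> (s *\<^sub>R e k))) (at t)"
      by (rule has_derivative_compose[where f="\<lambda>t. y + t *\<^sub>R e k" and g=g])
         (auto intro!: derivative_eq_intros C1_gradD(2)[OF that])
    then show ?thesis
      by (simp add: has_field_derivative_def e_def inner_axis mult_commute_abs)
  qed
  define g where "g t = f (x + h *\<^sub>R e j + t *\<^sub>R e i) - f (x + t *\<^sub>R e i)" for t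
  have dg: "(g has_real_derivative F (x + h *\<^sub>R e j + t *\<^sub>R e i) $ i - F (x + t *\<^sub>R e i) $ i) (at t)" for t
    unfolding g_def by (intro DERIV_diff d f)
  then obtain s where s: "0 < s" "s < h"
    "g h - g 0 = (h - 0) * (F (x + h *\<^sub>R e j + s *\<^sub>R e i) $ i - F (x + s *\<^sub>R e i) $ i)"
    using MVT2[OF h dg] by metis
  have dF: "((\<lambda>t. F ((x + s *\<^sub>R e i) + t *\<^sub>R e j) $ i) has_real_derivative
      Hi ((x + s *\<^sub>R e i) + t *\<^sub>R e j) $ j) (at t)" for t
    by (rule d[OF Fi])
  then obtain t where t: "0 < t" "t < h"
    "F ((x + s *\<^sub>R e i) + h *\<^sub>R e j) $ i - F ((x + s *\<^sub>R e i) + 0 *\<^sub>R e j) $ i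
      = (h - 0) * Hi ((x + s *\<^sub>R e i) + t *\<^sub>R e j) $ j"
    using MVT2[OF h dF] by metis
  have "f (x + h *\<^sub>R e i + h *\<^sub>R e j) - f (x + h *\<^sub>R e i) - f (x + h *\<^sub>R e j) + f x = g h - g 0"
    by (simp add: g_def add.commute add.left_commute)
  also have "\<dots> = h\<^sup>2 * Hi (x + s *\<^sub>R e i + t *\<^sub>R e j) $ j"
    using s(3) t(3) by (simp add: power2_eq_square add.commute add.left_commute)
  finally show ?thesis
    using s t h unfolding e_def by (intro exI[of _ s] exI[of _ t]) simp
qed

text \<open>
  The second order difference quotient is symmetric in \<open>i\<close> and \<open>j\<close>, and it converges to either of the
  two mixed derivatives as the step shrinks.
\<close>

lemma symmetric_second_partials:
  fixes f :: "real ^ 'n::finite \<Rightarrow> real"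
  assumes f: "C1_grad f F" and F: "\<And>i. C1_grad (\<lambda>x. F x $ i) (H i)"
  shows "H i x $ j = H j x $ i"
proof -
  define Q where "Q h = (f (x + h *\<^sub>R axis i 1 + h *\<^sub>R axis j 1) - f (x + h *\<^sub>R axis i 1)
      - f (x + h *\<^sub>R axis j 1) + f x) / h\<^sup>2" for h
  have lim: "(\<lambda>n. Q (1 / real (Suc n))) \<longlonglongrightarrow> H k x $ l"
    if "(k, l) = (i, j) \<or> (k, l) = (j, i)" for k l
  proof -
    have "Q h = (f (x + h *\<^sub>R axis k 1 + h *\<^sub>R axis l 1) - f (x + h *\<^sub>R axis k 1)
        - f (x + h *\<^sub>R axis l 1) + f x) / h\<^sup>2" for h
      using that unfolding Q_def by (auto simp: algebra_simps)
    then have "\<exists>s t. 0 < s \<and> s < 1 / real (Suc n) \<and> 0 < t \<and> t < 1 / real (Suc n) \<and>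
        Q (1 / real (Suc n)) = H k (x + s *\<^sub>R axis k 1 + t *\<^sub>R axis l 1) $ l" for n
      using mixed_difference_quotient[OF f F[of k], where h="1 / real (Suc n)" and x=x and j=l]
      by (simp only:) simp
    then obtain s t where st: "\<And>n. 0 < s n \<and> s n < 1 / real (Suc n) \<and> 0 < t n \<and> t n < 1 / real (Suc n) \<and>
        Q (1 / real (Suc n)) = H k (x + s n *\<^sub>R axis k 1 + t n *\<^sub>R axis l 1) $ l"
      by metis
    have z: "(\<lambda>n. 1 / real (Suc n)) \<longlonglongrightarrow> 0" by (rule LIMSEQ_Suc[OF lim_1_over_n])
    have "s \<longlonglongrightarrow> 0" "t \<longlonglongrightarrow> 0"
      by (rule tendsto_sandwich[OF _ _ tendsto_const z]; use st in \<open>auto intro!: eventuallyI less_imp_le\<close>)+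
    then have "(\<lambda>n. x + s n *\<^sub>R axis k 1 + t n *\<^sub>R axis l 1) \<longlonglongrightarrow> x + 0 *\<^sub>R axis k 1 + 0 *\<^sub>R axis l 1"
      by (intro tendsto_intros)
    moreover have "isCont (\<lambda>y. H k y $ l) x"
      using C1_gradD(1)[OF F, of k] by (simp add: continuous_on_eq_continuous_at continuous_intros)
    ultimately have "(\<lambda>n. H k (x + s n *\<^sub>R axis k 1 + t n *\<^sub>R axis l 1) $ l) \<longlonglongrightarrow> H k x $ l"
      by (intro isCont_tendsto_compose[of x "\<lambda>y. H k y $ l"]) simp_all
    then show ?thesis using st by simp
  qed
  show ?thesis by (rule LIMSEQ_unique[OF lim lim]) auto
qed

section \<open>The weight \<open>|x|\<^sup>a\<close>\<close>

lemma norm_pow_nonneg: "norm_pow a x \<ge> 0"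
  by (simp add: norm_pow_def)

lemma norm_pow_pos: "x \<noteq> 0 \<Longrightarrow> norm_pow a x > 0"
  by (simp add: norm_pow_def)

lemma norm_pow_mono:
  assumes "a \<ge> 0" "0 < r" "r \<le> norm x" shows "r powr a \<le> norm_pow a x"
  using assms by (auto simp: norm_pow_def powr_mono2)

lemma continuous_on_norm_pow:
  assumes "a \<ge> 0" shows "continuous_on S (norm_pow a)"
proof (cases "a = 0")
  case False
  then have "norm_pow a = (\<lambda>x :: real ^ 'a. norm x powr a)" by (simp add: norm_pow_def fun_eq_iff)
  moreover have "0 < a" using assms False by simp
  ultimately show ?thesis by (simp add: continuous_on_powr' continuous_intros)
qed (simp add: norm_pow_def[abs_def])

text \<open>
  The weight itself is not differentiable at the origin when \<open>0 < a \<le> 1\<close>, but the components of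
  \<open>x |x|\<^sup>a\<close> are, which is all that the divergence of \<open>x |x|\<^sup>a u\<^bsup>p+1\<^esup>\<close> requires.
\<close>

lemma C1_grad_component_norm_pow:
  assumes a: "a \<ge> 0"
  shows "C1_grad (\<lambda>x :: real ^ 'n::finite. x $ i * norm_pow a x)
    (\<lambda>x. norm_pow a x *\<^sub>R axis i 1 + (a * x $ i * norm x powr (a - 2)) *\<^sub>R x)"
proof (cases "a = 0")
  case True
  then show ?thesis using C1_grad_component[of i] by (simp add: norm_pow_def)
next
  case False
  with a have a: "a > 0" by simp
  let ?G = "\<lambda>x :: real ^ 'n. norm_pow a x *\<^sub>R axis i 1 + (a * x $ i * norm x powr (a - 2)) *\<^sub>R x"
  have np: "norm_pow a x = norm x powr a" for x :: "real ^ 'n" using a by (simp add: norm_pow_def)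
  have lim: "((\<lambda>x :: real ^ 'n. norm x powr a) \<longlongrightarrow> 0) (at 0)"
    using continuous_on_norm_pow[of a "UNIV :: (real^'n) set"] a
    by (simp add: continuous_on_def np[abs_def] np) (drule spec[of _ 0], simp)
  show ?thesis
  proof (rule C1_gradI)
    show "continuous_on UNIV ?G"
    proof -
      have "isCont (\<lambda>x. (a * x $ i * norm x powr (a - 2)) *\<^sub>R x) x" for x :: "real ^ 'n"
      proof (cases "x = 0")
        case False then show ?thesis by (intro continuous_intros) auto
      next
        case True
        have "((\<lambda>x :: real ^ 'n. (a * x $ i * norm x powr (a - 2)) *\<^sub>R x) \<longlongrightarrow> 0) (at 0)"
        proof (rule Lim_null_comparison)
          show "((\<lambda>x :: real ^ 'n. a * norm x powr a) \<longlongrightarrow> 0) (at 0)"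
            using tendsto_mult_right_zero[OF lim] by simp
          have "norm ((a * x $ i * norm x powr (a - 2)) *\<^sub>R x) \<le> a * norm x powr a"
            if "x \<noteq> 0" for x :: "real ^ 'n"
          proof -
            have "norm ((a * x $ i * norm x powr (a - 2)) *\<^sub>R x) = \<bar>x $ i\<bar> * (a * norm x powr (a - 2) * norm x)"
              using a by (simp add: abs_mult)
            also have "\<dots> \<le> norm x * (a * norm x powr (a - 2) * norm x)"
              using a by (intro mult_right_mono component_le_norm_cart) auto
            also have "\<dots> = a * (norm x powr (a - 2) * norm x powr 2)"
              by (simp add: power2_eq_square)
            also have "\<dots> = a * norm x powr a"
              by (metis powr_add diff_add_cancel)
            finally show ?thesis .
          qed
          then show "\<forall>\<^sub>F x :: real ^ 'n in at 0. norm ((a * x $ i * norm x powr (a - 2)) *\<^sub>R x) \<le> a * norm x powr a"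
            by (auto simp: eventually_at intro!: exI[of _ 1])
        qed
        then show ?thesis using True by (simp add: isCont_def)
      qed
      then have "continuous_on UNIV (\<lambda>x :: real ^ 'n. (a * x $ i * norm x powr (a - 2)) *\<^sub>R x)"
        by (intro continuous_at_imp_continuous_on ballI)
      moreover have "continuous_on UNIV (norm_pow a :: real ^ 'n \<Rightarrow> real)"
        using a by (intro continuous_on_norm_pow) simp
      ultimately show ?thesis
        by (intro continuous_on_add[OF continuous_on_scaleR[OF _ continuous_on_const]])
    qed
    show "((\<lambda>x. x $ i * norm_pow a x) has_derivative (\<lambda>h. ?G x \<bullet> h)) (at x)" for x
    proof (cases "x = 0")
      case False
      have "((\<lambda>x. norm x powr a) has_derivative (\<lambda>h. a * norm x powr (a - 2) * (x \<bullet> h))) (at x)"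
      proof -
        have "((\<lambda>x. norm x powr a) has_derivative (\<lambda>h. norm x powr a * (0 * ln (norm x) + (h \<bullet> sgn x) * a / norm x))) (at x)"
          using False by (auto intro!: derivative_eq_intros has_derivative_norm)
        moreover have "norm x powr a * (0 * ln (norm x) + (h \<bullet> sgn x) * a / norm x) = a * norm x powr (a - 2) * (x \<bullet> h)" for h
          using False by (simp add: sgn_div_norm powr_diff inner_commute power2_eq_square field_simps)
        ultimately show ?thesis by simp
      qed
      from has_derivative_mult[OF bounded_linear_imp_has_derivative[OF bounded_linear_vec_nth[of i]] this]
      show ?thesis
        unfolding np by (rule has_derivative_eq_rhs)
           (simp add: fun_eq_iff inner_axis' algebra_simps)
    next
      case True
      have "((\<lambda>h :: real ^ 'n. norm (h $ i * norm h powr a) / norm h) \<longlongrightarrow> 0) (at 0)"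
      proof (rule Lim_null_comparison[OF _ lim])
        have "norm (norm (h $ i * norm h powr a) / norm h) \<le> norm h powr a" if "h \<noteq> 0" for h :: "real ^ 'n"
          using that mult_right_mono[OF component_le_norm_cart[of h i], of "norm h powr a"]
          by (simp add: abs_mult divide_le_eq mult.commute)
        then show "\<forall>\<^sub>F h :: real ^ 'n in at 0. norm (norm (h $ i * norm h powr a) / norm h) \<le> norm h powr a"
          by (auto simp: eventually_at intro!: exI[of _ 1])
      qed
      then show ?thesis using True a by (simp add: has_derivative_at np)
    qed
  qed
qed

section \<open>The Pohozaev identity\<close>

lemma continuous_on_weighted_power:
  assumes "a \<ge> 0" "continuous_on UNIV u" "\<And>x. u x > 0"
  shows "continuous_on UNIV (\<lambda>x. norm_pow a x * u x powr q)"
proof -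
  have "u x \<noteq> 0" for x using assms(3)[of x] by simp
  then show ?thesis by (intro continuous_intros continuous_on_norm_pow assms) auto
qed

lemma C1_grad_powr:
  assumes "C1_grad u U" "\<And>x. u x > 0"
  shows "C1_grad (\<lambda>x. u x powr q) (\<lambda>x. (q * u x powr (q - 1)) *\<^sub>R U x)"
proof -
  have "u x \<noteq> 0" for x using assms(2)[of x] by simp
  then show ?thesis
    using assms(2)
    by (intro C1_grad_compose[OF assms(1), of "\<lambda>t. t powr q" "\<lambda>t. q * t powr (q - 1)"]
        has_real_derivative_powr continuous_intros C1_grad_continuous[OF assms(1)]) auto
qed

text \<open>
  The Hessian is given by the gradients \<open>H i\<close> of the components of the gradient \<open>U\<close>, and the Laplacian
  is its trace.
\<close>

locale henon_solution =
  fixes a p N :: real and u :: "real ^ 'n::finite \<Rightarrow> real"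
    and U :: "real ^ 'n \<Rightarrow> real ^ 'n" and H :: "'n \<Rightarrow> real ^ 'n \<Rightarrow> real ^ 'n"
  assumes a: "a \<ge> 0" and p: "p > 1" and N: "N = real CARD('n)"
    and U: "C1_grad u U" and H: "\<And>i. C1_grad (\<lambda>x. U x $ i) (H i)"
    and pos: "\<And>x. u x > 0"
    and eqn: "\<And>x. (\<Sum>i\<in>UNIV. H i x $ i) = - (norm_pow a x * u x powr p)"
begin

definition E :: "real ^ 'n \<Rightarrow> real" where
  "E x = norm_pow a x * u x powr (p + 1)"

lemma E_nonneg: "E x \<ge> 0"
  by (simp add: E_def norm_pow_nonneg)

lemma continuous_u: "continuous_on UNIV u"
  by (rule C1_grad_continuous[OF U])

lemma continuous_E: "continuous_on UNIV E"
  unfolding E_def[abs_def] by (intro continuous_on_weighted_power a continuous_u pos)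

lemma u_mult_powr: "u x * u x powr p = u x powr (p + 1)" "u x powr p * u x = u x powr (p + 1)"
  using pos[of x] by (simp_all add: powr_add)

text \<open>
  This is \<open>u \<nabla>u\<close>. Testing its divergence with \<open>\<eta>\<close> amounts to testing the equation with \<open>u \<eta>\<close>.
\<close>

definition energy_field :: "'n \<Rightarrow> real ^ 'n \<Rightarrow> real" where
  "energy_field i x = u x * U x $ i"

definition energy_field_grad :: "'n \<Rightarrow> real ^ 'n \<Rightarrow> real ^ 'n" where
  "energy_field_grad i x = u x *\<^sub>R H i x + U x $ i *\<^sub>R U x"

lemma C1_grad_energy_field: "C1_grad (energy_field i) (energy_field_grad i)"
  unfolding energy_field_def[abs_def] energy_field_grad_def[abs_def] by (rule C1_grad_mult[OF U H])

lemma div_energy_field: "(\<Sum>i\<in>UNIV. energy_field_grad i x $ i) = (norm (U x))\<^sup>2 - E x"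
proof -
  have "(\<Sum>i\<in>UNIV. energy_field_grad i x $ i) = u x * (\<Sum>i\<in>UNIV. H i x $ i) + U x \<bullet> U x"
    by (simp add: energy_field_grad_def sum.distrib sum_distrib_left inner_vec_def)
  also have "\<dots> = (norm (U x))\<^sup>2 - E x"
    by (simp add: eqn E_def dot_square_norm u_mult_powr mult.left_commute)
  finally show ?thesis .
qed

text \<open>
  The first two terms come from testing the equation with \<open>x \<bullet> \<nabla>u\<close>, the generator of dilations, and
  the third accounts for the nonlinearity \<open>w u\<^sup>p (x \<bullet> \<nabla>u)\<close>. Their divergence still contains
  \<open>-(N-2)/2 |\<nabla>u|\<^sup>2\<close>. The multiple of the energy field is chosen to cancel it.
\<close>

definition pohozaev_field :: "'n \<Rightarrow> real ^ 'n \<Rightarrow> real" where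
  "pohozaev_field i x = (x \<bullet> U x) * U x $ i - x $ i * (norm (U x))\<^sup>2 / 2
     + x $ i * E x / (p + 1) + (N - 2) / 2 * (u x * U x $ i)"

text \<open>
  The second derivatives of \<open>u\<close> cancel. The divergence of the first two terms contains them as
  \<open>\<Sum>\<^sub>i\<^sub>j x\<^sub>j u\<^sub>i \<partial>\<^sub>i u\<^sub>j - \<Sum>\<^sub>i\<^sub>j x\<^sub>i u\<^sub>j \<partial>\<^sub>i u\<^sub>j\<close>, which is \<open>0\<close> by symmetry of the Hessian, and as
  \<open>(x \<bullet> \<nabla>u) \<Delta>u\<close>, which the equation turns into the negative of the term \<open>w u\<^sup>p (x \<bullet> \<nabla>u)\<close> that the third
  one produces. The last term contributes \<open>u \<Delta>u = -E\<close>, up to its constant.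
\<close>

lemma pohozaev_identity:
  assumes \<eta>: "C1_grad \<eta> G" and supp: "\<And>x. r < norm x \<Longrightarrow> \<eta> x = 0"
  shows "((N + a) / (p + 1) - (N - 2) / 2) * (LINT x|lborel. \<eta> x * E x)
    = - (LINT x|lborel. (\<Sum>i\<in>UNIV. G x $ i * pohozaev_field i x))"
proof -
  define S where "S x = x \<bullet> U x" for x
  define DS where "DS x = U x + (\<Sum>j\<in>UNIV. x $ j *\<^sub>R H j x)" for x
  define Q where "Q x = (norm (U x))\<^sup>2" for x
  define DQ where "DQ x = (\<Sum>j\<in>UNIV. (2 * U x $ j) *\<^sub>R H j x)" for x
  define P where "P i x = x $ i * norm_pow a x" for i and x :: "real ^ 'n"
  define DP where "DP i x = norm_pow a x *\<^sub>R axis i 1 + (a * x $ i * norm x powr (a - 2)) *\<^sub>R x"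
    for i and x :: "real ^ 'n"
  have S: "C1_grad S DS"
  proof -
    have "C1_grad (\<lambda>x. \<Sum>j\<in>UNIV. x $ j * U x $ j) (\<lambda>x. \<Sum>j\<in>UNIV. x $ j *\<^sub>R H j x + U x $ j *\<^sub>R axis j 1)"
      by (intro C1_grad_sum C1_grad_mult C1_grad_component H) simp
    moreover have "(\<Sum>j\<in>UNIV. U x $ j *\<^sub>R axis j 1) = U x" for x
      using basis_expansion[of "U x"] by (simp add: scalar_mult_eq_scaleR)
    ultimately show ?thesis
      by (simp add: S_def[abs_def] DS_def[abs_def] inner_vec_def sum.distrib add.commute)
  qed
  have Q: "C1_grad Q DQ"
  proof -
    have "C1_grad (\<lambda>x. \<Sum>j\<in>UNIV. U x $ j * U x $ j) (\<lambda>x. \<Sum>j\<in>UNIV. U x $ j *\<^sub>R H j x + U x $ j *\<^sub>R H j x)"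
      by (intro C1_grad_sum C1_grad_mult H) simp
    then show ?thesis
      by (simp add: Q_def[abs_def] DQ_def[abs_def] dot_square_norm[symmetric] inner_vec_def
          scaleR_add_left[symmetric])
  qed
  have P: "C1_grad (P i) (DP i)" for i
    unfolding P_def[abs_def] DP_def[abs_def] by (rule C1_grad_component_norm_pow[OF a])
  note up = C1_grad_powr[OF U pos, of "p + 1"]
  define V where "V i x = S x * U x $ i - 1 / 2 * (x $ i * Q x)
      + 1 / (p + 1) * (P i x * u x powr (p + 1)) + (N - 2) / 2 * energy_field i x" for i x
  define DV where "DV i x = (S x *\<^sub>R H i x + U x $ i *\<^sub>R DS x)
      - (1 / 2) *\<^sub>R (x $ i *\<^sub>R DQ x + Q x *\<^sub>R axis i 1)
      + (1 / (p + 1)) *\<^sub>R (P i x *\<^sub>R ((p + 1) * u x powr (p + 1 - 1)) *\<^sub>R U x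
            + u x powr (p + 1) *\<^sub>R DP i x)
      + ((N - 2) / 2) *\<^sub>R energy_field_grad i x" for i x
  have V: "C1_grad (V i) (DV i)" for i
    unfolding V_def[abs_def] DV_def[abs_def]
    by (intro C1_grad_add C1_grad_diff C1_grad_cmult C1_grad_mult[OF S H]
        C1_grad_mult[OF C1_grad_component Q] C1_grad_mult[OF P up] C1_grad_energy_field)
  have V_eq: "V i x = pohozaev_field i x" for i x
    by (simp add: V_def pohozaev_field_def S_def Q_def P_def E_def energy_field_def)
  have div: "(\<Sum>i\<in>UNIV. DV i x $ i) = ((N + a) / (p + 1) - (N - 2) / 2) * E x" for x
  proof -
    let ?w = "norm_pow a x"
    have 1: "(\<Sum>i\<in>UNIV. S x * H i x $ i) = - S x * ?w * u x powr p"
      by (simp add: sum_distrib_left[symmetric] eqn)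
    have 2: "(\<Sum>i\<in>UNIV. U x $ i * DS x $ i) = Q x + (\<Sum>i\<in>UNIV. \<Sum>j\<in>UNIV. U x $ i * (x $ j * H j x $ i))"
      by (simp add: DS_def Q_def distrib_left sum.distrib sum_distrib_left dot_square_norm[symmetric] inner_vec_def)
    have 3: "(\<Sum>i\<in>UNIV. x $ i * DQ x $ i) = 2 * (\<Sum>i\<in>UNIV. \<Sum>j\<in>UNIV. U x $ i * (x $ j * H j x $ i))"
    proof -
      have "(\<Sum>i\<in>UNIV. x $ i * DQ x $ i) = 2 * (\<Sum>j\<in>UNIV. \<Sum>i\<in>UNIV. U x $ i * (x $ j * H i x $ j))"
        by (simp add: DQ_def sum_distrib_left mult.assoc mult.left_commute)
      also have "\<dots> = 2 * (\<Sum>i\<in>UNIV. \<Sum>j\<in>UNIV. U x $ i * (x $ j * H i x $ j))"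
        by (subst sum.swap) simp
      finally show ?thesis by (simp add: symmetric_second_partials[OF U H, of _ x])
    qed
    have 4: "(\<Sum>i\<in>UNIV. P i x * ((p + 1) * u x powr p * U x $ i)) = (p + 1) * ?w * u x powr p * S x"
      by (simp add: P_def S_def inner_vec_def sum_distrib_left mult_ac)
    have 5: "(\<Sum>i\<in>UNIV. DP i x $ i) = (N + a) * ?w"
    proof -
      have "(\<Sum>i\<in>UNIV. DP i x $ i) = N * ?w + a * norm x powr (a - 2) * (\<Sum>i\<in>UNIV. x $ i * x $ i)"
        by (simp add: DP_def N sum.distrib sum_distrib_left mult_ac)
      also have "(\<Sum>i\<in>UNIV. x $ i * x $ i) = (norm x)\<^sup>2"
        by (simp add: dot_square_norm[symmetric] inner_vec_def)
      also have "a * norm x powr (a - 2) * (norm x)\<^sup>2 = a * ?w"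
        by (cases "x = 0") (auto simp: norm_pow_def powr_diff)
      finally show ?thesis by (simp add: algebra_simps)
    qed
    have "(\<Sum>i\<in>UNIV. DV i x $ i) = (\<Sum>i\<in>UNIV. S x * H i x $ i) + (\<Sum>i\<in>UNIV. U x $ i * DS x $ i)
        - 1 / 2 * ((\<Sum>i\<in>UNIV. x $ i * DQ x $ i) + N * Q x)
        + 1 / (p + 1) * ((\<Sum>i\<in>UNIV. P i x * ((p + 1) * u x powr p * U x $ i))
            + u x powr (p + 1) * (\<Sum>i\<in>UNIV. DP i x $ i))
        + (N - 2) / 2 * (\<Sum>i\<in>UNIV. energy_field_grad i x $ i)"
      by (simp add: DV_def N sum.distrib sum_subtractf sum_distrib_left[symmetric] sum_divide_distrib[symmetric] mult.assoc
          right_diff_distrib[symmetric])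
    also have "\<dots> = ((N + a) / (p + 1) - (N - 2) / 2) * E x"
      unfolding 1 2 3 4 5 div_energy_field Q_def[symmetric]
      using p by (simp add: E_def field_simps)
    finally show ?thesis .
  qed
  have "(LINT x|lborel. \<eta> x * (((N + a) / (p + 1) - (N - 2) / 2) * E x))
      = - (LINT x|lborel. (\<Sum>i\<in>UNIV. G x $ i * pohozaev_field i x))"
    unfolding div[symmetric] V_eq[symmetric] by (rule integral_by_parts_div[OF \<eta> _ V]) (rule supp)
  moreover have "(LINT x|lborel. \<eta> x * (d * E x)) = d * (LINT x|lborel. \<eta> x * E x)" for d
    by (simp add: mult.left_commute[of _ d])
  ultimately show ?thesis by simp
qed

end

section \<open>Finite Morse index implies stability outside a ball\<close>

lemma I_uu_add_disjoint_support:
  fixes u :: "real ^ 'n::finite \<Rightarrow> real"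
  assumes a: "a \<ge> 0" and u: "continuous_on UNIV u" "\<And>x. u x > 0"
    and f: "C1_grad f F" "\<And>x. r < norm x \<Longrightarrow> f x = 0"
    and g: "C1_grad g G" "\<And>x. norm x < r' \<Longrightarrow> g x = 0" "\<And>x. s < norm x \<Longrightarrow> g x = 0" and "r < r'"
  shows "I_uu a p u (\<lambda>x. f x + g x) = I_uu a p u f + I_uu a p u g"
proof -
  have F0: "F x = 0" if "r < norm x" for x by (rule C1_grad_eq_0_outside[OF f that])
  have G0: "G x = 0" if "s < norm x" for x by (rule C1_grad_eq_0_outside[OF g(1,3) that])
  have G1: "G x = 0" if "norm x < r'" for x
    by (rule C1_grad_eq_0[OF g(1), of "ball 0 r'"]) (use that g(2) in auto)
  have FG: "F x = 0 \<or> G x = 0" and fg: "f x = 0 \<or> g x = 0" for x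
    using F0[of x] G1[of x] f(2)[of x] g(2)[of x] \<open>r < r'\<close> by linarith+
  have w: "continuous_on UNIV (\<lambda>x. norm_pow a x * u x powr (p - 1))"
    by (intro continuous_on_weighted_power a u)
  have I1: "integrable lborel (\<lambda>x. (norm (F x))\<^sup>2)" "integrable lborel (\<lambda>x. (norm (G x))\<^sup>2)"
    by (rule integrable_compactly_supported[where r=r] integrable_compactly_supported[where r=s];
        auto simp: F0 G0 intro!: continuous_intros C1_gradD(1)[OF f(1)] C1_gradD(1)[OF g(1)])+
  have I2: "integrable lborel (\<lambda>x. norm_pow a x * u x powr (p - 1) * (f x)\<^sup>2)"
    by (rule integrable_compactly_supported[where r=r])
       (auto simp: f(2) intro!: continuous_on_mult[OF w] continuous_intros C1_grad_continuous[OF f(1)])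
  have I3: "integrable lborel (\<lambda>x. norm_pow a x * u x powr (p - 1) * (g x)\<^sup>2)"
    by (rule integrable_compactly_supported[where r=s])
       (auto simp: g(3) intro!: continuous_on_mult[OF w] continuous_intros C1_grad_continuous[OF g(1)])
  have "(norm (F x + G x))\<^sup>2 = (norm (F x))\<^sup>2 + (norm (G x))\<^sup>2" for x
    using FG[of x] by auto
  moreover have "norm_pow a x * u x powr (p - 1) * (f x + g x)\<^sup>2
      = norm_pow a x * u x powr (p - 1) * (f x)\<^sup>2 + norm_pow a x * u x powr (p - 1) * (g x)\<^sup>2" for x
    using fg[of x] by auto
  ultimately show ?thesis
    using I1 I2 I3
    by (simp add: I_uu_def C1_grad_grad[OF f(1)] C1_grad_grad[OF g(1)]
        C1_grad_grad[OF C1_grad_add[OF f(1) g(1)]] distrib_left)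
qed

lemma I_uu_scale:
  assumes f: "C1_grad f F"
  shows "I_uu a p u (\<lambda>x. c * f x) = c\<^sup>2 * I_uu a p u f"
  by (simp add: I_uu_def C1_grad_grad[OF f] C1_grad_grad[OF C1_grad_cmult[OF f]]
      power_mult_distrib mult.left_commute[of _ "c\<^sup>2"] right_diff_distrib)

lemma C1c_obtain:
  fixes f :: "real ^ 'n::finite \<Rightarrow> real"
  assumes "f \<in> C1c"
  obtains F r where "C1_grad f F" "\<And>x. r < norm x \<Longrightarrow> f x = 0"
  using assms C1_grad_of_C1 by (auto simp: C1c_iff)

lemma C1cI:
  fixes f :: "real ^ 'n::finite \<Rightarrow> real"
  assumes "C1_grad f F" "\<And>x. r < norm x \<Longrightarrow> f x = 0" shows "f \<in> C1c"
  using assms C1_grad_imp_C1 by (auto simp: C1c_iff)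

definition stable_outside :: "real \<Rightarrow> real \<Rightarrow> (real ^ 'n::finite \<Rightarrow> real) \<Rightarrow> real \<Rightarrow> bool" where
  "stable_outside a p u r \<longleftrightarrow> (\<forall>\<phi>\<in>C1c. (\<forall>x. norm x < r \<longrightarrow> \<phi> x = 0) \<longrightarrow> I_uu a p u \<phi> \<ge> 0)"

lemma common_support_radius:
  fixes B :: "(real ^ 'n::finite \<Rightarrow> real) set"
  assumes "finite B" "B \<subseteq> C1c"
  shows "\<exists>r. \<forall>\<phi>\<in>fun_space.span B. \<forall>x. r < norm x \<longrightarrow> \<phi> x = 0"
proof -
  have "\<forall>b\<in>B. \<exists>r. \<forall>x. r < norm x \<longrightarrow> b x = 0" using assms(2) by (auto simp: C1c_iff)
  then obtain \<rho> where \<rho>: "\<And>b x. b \<in> B \<Longrightarrow> \<rho> b < norm x \<Longrightarrow> b x = 0" by metis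
  define r where "r = Max (insert 0 (\<rho> ` B))"
  have "\<phi> x = 0" if "\<phi> \<in> fun_space.span B" "r < norm x" for \<phi> x
    using that(1)
  proof (induction rule: fun_space.span_induct_alt)
    case (step c b y)
    have "\<rho> b \<le> r" using step(1) assms(1) by (auto simp: r_def)
    then show ?case using step \<rho>[of b x] that(2) by (simp add: fun_scale_def plus_fun_def)
  qed simp
  then show ?thesis by blast
qed

lemma has_finite_dim_span:
  assumes "has_finite_dim (fun_space.span A) k" "fun_space.independent A"
  shows "finite A \<and> card A \<le> k"
  using assms fun_space.independent_span_bound fun_space.span_superset
  unfolding has_finite_dim_def by metis

text \<open>
  The elements of a negative subspace \<open>X\<close> of maximal dimension vanish outside a common ball. A test
  function \<open>\<psi>\<close> that is supported outside a slightly larger ball and makes the quadratic form negative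
  would not interact with \<open>X\<close>, so the span of \<open>X\<close> and \<open>\<psi>\<close> would be a negative subspace of larger
  dimension.
\<close>

lemma finite_morse_index_imp_stable_outside:
  fixes u :: "real ^ 'n::finite \<Rightarrow> real"
  assumes a: "a \<ge> 0" and u: "continuous_on UNIV u" "\<And>x. u x > 0"
    and fmi: "finite_morse_index a p u"
  shows "\<exists>r. stable_outside a p u r"
proof (cases "stable a p u")
  case True
  then show ?thesis by (auto simp: stable_def stable_outside_def)
next
  case False
  with fmi obtain m where "has_morse_index a p u m" by (auto simp: finite_morse_index_def)
  then obtain X where X: "negative_subspace a p u X" "has_finite_dim X m"
    and max: "\<And>Y. negative_subspace a p u Y \<Longrightarrow> \<exists>k\<le>m. has_finite_dim Y k"
    by (auto simp: has_morse_index_def)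
  obtain B where B: "finite B" "card B = m" "fun_space.independent B" "fun_space.span B = X"
    using X(2) by (auto simp: has_finite_dim_def)
  have XC: "X \<subseteq> C1c" and Xneg: "\<And>\<phi>. \<phi> \<in> X \<Longrightarrow> \<phi> \<noteq> 0 \<Longrightarrow> I_uu a p u \<phi> < 0"
    using X(1) by (auto simp: negative_subspace_def)
  have "B \<subseteq> C1c" using XC B(4) fun_space.span_superset by blast
  then obtain r where r: "\<And>\<phi> x. \<phi> \<in> X \<Longrightarrow> r < norm x \<Longrightarrow> \<phi> x = 0"
    using common_support_radius[OF B(1)] B(4) by metis
  \<comment> \<open>The gap between the radii makes the gradients have disjoint supports as well: near every point
    one of the two functions vanishes identically.\<close>
  have "stable_outside a p u (r + 1)"
    unfolding stable_outside_def
  proof (intro ballI impI, rule ccontr)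
    fix \<psi> :: "real ^ 'n \<Rightarrow> real"
    assume \<psi>C: "\<psi> \<in> C1c" and \<psi>0: "\<forall>x. norm x < r + 1 \<longrightarrow> \<psi> x = 0" and "\<not> 0 \<le> I_uu a p u \<psi>"
    then have \<psi>neg: "I_uu a p u \<psi> < 0" by simp
    obtain G s where \<psi>: "C1_grad \<psi> G" "\<And>x. s < norm x \<Longrightarrow> \<psi> x = 0"
      by (rule C1c_obtain[OF \<psi>C]) blast
    have I0: "I_uu a p u (\<lambda>x. 0) = 0"
      using I_uu_scale[OF \<psi>(1), of a p u 0] by simp
    have decomp: "\<phi> + fun_scale c \<psi> \<in> C1c \<and>
        I_uu a p u (\<phi> + fun_scale c \<psi>) = I_uu a p u \<phi> + c\<^sup>2 * I_uu a p u \<psi>" if "\<phi> \<in> X" for \<phi> c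
    proof -
      have "\<phi> \<in> C1" using XC that by (auto simp: C1c_def)
      then obtain F where F: "C1_grad \<phi> F" using C1_grad_of_C1 by blast
      have eq: "\<phi> + fun_scale c \<psi> = (\<lambda>x. \<phi> x + c * \<psi> x)" by (simp add: fun_eq_iff fun_scale_def)
      show ?thesis
        unfolding eq I_uu_scale[OF \<psi>(1), symmetric]
      proof
        show "(\<lambda>x. \<phi> x + c * \<psi> x) \<in> C1c"
          by (rule C1cI[OF C1_grad_add[OF F C1_grad_cmult[OF \<psi>(1)]], of "max r s"])
             (simp add: r[OF that] \<psi>(2))
        show "I_uu a p u (\<lambda>x. \<phi> x + c * \<psi> x) = I_uu a p u \<phi> + I_uu a p u (\<lambda>x. c * \<psi> x)"
          by (rule I_uu_add_disjoint_support[OF a u F _ C1_grad_cmult[OF \<psi>(1)], where r'="r+1" and r=r and s=s])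
             (use r[OF that] \<psi>0 \<psi>(2) in auto)
      qed
    qed
    have \<psi>X: "\<psi> \<notin> X"
    proof
      assume "\<psi> \<in> X"
      have "\<psi> x = 0" for x
        using r[OF \<open>\<psi> \<in> X\<close>, of x] \<psi>0 by (cases "r < norm x") auto
      then have "\<psi> = (\<lambda>x. 0)" by auto
      with \<psi>neg I0 show False by simp
    qed
    have "negative_subspace a p u (fun_space.span (insert \<psi> B))"
      unfolding negative_subspace_def
    proof (intro conjI ballI subsetI)
      show "fun_space.subspace (fun_space.span (insert \<psi> B))" by (rule fun_space.subspace_span)
      have split: "\<exists>c \<phi>. \<phi> \<in> X \<and> f = \<phi> + fun_scale c \<psi>" if f: "f \<in> fun_space.span (insert \<psi> B)" for f
      proof -
        obtain c where "f - fun_scale c \<psi> \<in> X" using f fun_space.span_breakdown_eq B(4) by metis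
        then show ?thesis by (intro exI[of _ c] exI[of _ "f - fun_scale c \<psi>"]) simp
      qed
      show "f \<in> C1c" if "f \<in> fun_space.span (insert \<psi> B)" for f using split[OF that] decomp by blast
      show "I_uu a p u f < 0" if fS: "f \<in> fun_space.span (insert \<psi> B) - {0}" for f
      proof -
        obtain c \<phi> where f: "\<phi> \<in> X" "f = \<phi> + fun_scale c \<psi>" using split fS by blast
        have If: "I_uu a p u f = I_uu a p u \<phi> + c\<^sup>2 * I_uu a p u \<psi>" using decomp f by blast
        have le: "I_uu a p u \<phi> \<le> 0"
          using Xneg[OF f(1)] I0 by (cases "\<phi> = 0") (auto simp: zero_fun_def)
        show ?thesis
        proof (cases "c = 0")
          case True
          then have "f = \<phi>" using f(2) by (simp add: fun_scale_def fun_eq_iff)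
          then show ?thesis using Xneg[OF f(1)] that by simp
        next
          case False
          then have "c\<^sup>2 * I_uu a p u \<psi> < 0" using \<psi>neg by (simp add: mult_pos_neg)
          then show ?thesis using If le by simp
        qed
      qed
    qed
    then obtain k where k: "k \<le> m" "has_finite_dim (fun_space.span (insert \<psi> B)) k" using max by blast
    have "fun_space.independent (insert \<psi> B)"
      using B(3,4) \<psi>X by (simp add: fun_space.independent_insert)
    then have "card (insert \<psi> B) \<le> m" using has_finite_dim_span[OF k(2)] k(1) by linarith
    moreover have "\<psi> \<notin> B" using \<psi>X B(4) fun_space.span_superset by blast
    ultimately show False using B(1,2) by simp
  qed
  then show ?thesis by blast
qed

section \<open>Cutoff functions\<close>

lemma DERIV_positive_part_square: "((\<lambda>t::real. (max 0 t)\<^sup>2) has_real_derivative 2 * max 0 t) (at t)"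
proof -
  have "\<bar>((max 0 (t + h))\<^sup>2 - (max 0 t)\<^sup>2) / h - 2 * max 0 t\<bar> \<le> \<bar>h\<bar>" if "h \<noteq> 0" for h
  proof -
    have "\<bar>(max 0 (t + h))\<^sup>2 - (max 0 t)\<^sup>2 - 2 * max 0 t * h\<bar> \<le> h\<^sup>2"
    proof (cases "0 \<le> t"; cases "0 \<le> t + h")
      assume *: "0 \<le> t" "\<not> 0 \<le> t + h"
      have "0 \<le> t * (- 2 * h - t)" using * by (intro mult_nonneg_nonneg) auto
      moreover have "0 \<le> (t + h)\<^sup>2" by simp
      ultimately show ?thesis using * by (auto simp: power2_eq_square algebra_simps)
    next
      assume *: "\<not> 0 \<le> t" "0 \<le> t + h"
      then show ?thesis using power_mono[of "t + h" h 2] by auto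
    qed (auto simp: power2_eq_square algebra_simps)
    then have "\<bar>(max 0 (t + h))\<^sup>2 - (max 0 t)\<^sup>2 - 2 * max 0 t * h\<bar> / \<bar>h\<bar> \<le> h\<^sup>2 / \<bar>h\<bar>"
      by (rule divide_right_mono) simp
    moreover have "h\<^sup>2 / \<bar>h\<bar> = \<bar>h\<bar>"
      using that by (simp add: divide_eq_eq power2_eq_square)
    moreover have "((max 0 (t + h))\<^sup>2 - (max 0 t)\<^sup>2) / h - 2 * max 0 t
        = ((max 0 (t + h))\<^sup>2 - (max 0 t)\<^sup>2 - 2 * max 0 t * h) / h"
      using that by (simp add: diff_divide_distrib)
    ultimately show ?thesis using that by (simp add: abs_divide)
  qed
  then have "((\<lambda>h. ((max 0 (t + h))\<^sup>2 - (max 0 t)\<^sup>2) / h - 2 * max 0 t) \<longlongrightarrow> 0) (at 0)"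
    by (intro Lim_null_comparison[OF _ tendsto_rabs_zero[OF tendsto_ident_at]])
       (simp add: eventually_at_filter)
  then show ?thesis by (simp add: DERIV_def LIM_zero_iff)
qed

text \<open>
  With \<open>f t = (max 0 t)\<^sup>2\<close> the quotient \<open>f t / (f t + f (1 - t))\<close> is as required: \<open>f\<close> is \<open>C\<^sup>1\<close>, and its
  denominator is positive because \<open>t\<close> and \<open>1 - t\<close> are not both nonpositive.
\<close>

lemma C1_step_function:
  obtains s s' :: "real \<Rightarrow> real" and K where
    "\<And>t. (s has_real_derivative s' t) (at t)" "continuous_on UNIV s'"
    "\<And>t. 0 \<le> s t" "\<And>t. s t \<le> 1" "\<And>t. t \<le> 0 \<Longrightarrow> s t = 0" "\<And>t. 1 \<le> t \<Longrightarrow> s t = 1"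
    "\<And>t. t \<le> 0 \<or> 1 \<le> t \<Longrightarrow> s' t = 0" "\<And>t. \<bar>s' t\<bar> \<le> K"
proof -
  define f where "f t = (max 0 t)\<^sup>2" for t :: real
  define f' where "f' t = 2 * max 0 t" for t :: real
  define d where "d t = f t + f (1 - t)" for t
  define s where "s t = f t / d t" for t
  define s' where "s' t = (f' t * d t - f t * (f' t - f' (1 - t))) / (d t * d t)" for t
  have d: "d t > 0" for t
  proof (cases "t > 0")
    case True
    then show ?thesis unfolding d_def f_def by (intro add_pos_nonneg) auto
  next
    case False
    then show ?thesis unfolding d_def f_def by (intro add_nonneg_pos) auto
  qed
  have Df: "(f has_real_derivative f' t) (at t)" for t
    unfolding f_def[abs_def] f'_def by (rule DERIV_positive_part_square)
  have Df1: "((\<lambda>t. f (1 - t)) has_real_derivative - f' (1 - t)) (at t)" for t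
    by (rule DERIV_cong[OF DERIV_chain2[OF Df, of "\<lambda>t. 1 - t" "-1"]]) (auto intro!: derivative_eq_intros)
  have Dd: "(d has_real_derivative f' t - f' (1 - t)) (at t)" for t
    unfolding d_def[abs_def] using DERIV_add[OF Df Df1] by simp
  have Ds: "(s has_real_derivative s' t) (at t)" for t
    unfolding s_def[abs_def] s'_def using DERIV_divide[OF Df Dd] d[of t] by simp
  have cd: "continuous_on UNIV d" unfolding d_def f_def by (intro continuous_intros)
  have cs: "continuous_on UNIV s'"
    unfolding s'_def f_def f'_def
    by (intro continuous_intros cd) (use d in \<open>auto simp: less_imp_neq[symmetric]\<close>)
  have s0: "s' t = 0" if "t \<le> 0 \<or> 1 \<le> t" for t
    using that by (auto simp: s'_def f_def f'_def d_def)
  have "compact (s' ` {0..1})"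
    by (intro compact_continuous_image continuous_on_subset[OF cs]) auto
  then obtain K where K: "\<forall>t\<in>{0..1}. \<bar>s' t\<bar> \<le> K"
    using compact_imp_bounded[of "s' ` {0..1}"] by (auto simp: bounded_iff)
  have "0 \<le> K" by (rule order_trans[OF abs_ge_zero bspec[OF K, of 0]]) simp
  then have K': "\<bar>s' t\<bar> \<le> K" for t
    using K s0[of t] by (cases "t \<in> {0..1}") auto
  show ?thesis
  proof (rule that[OF Ds cs _ _ _ _ s0 K'])
    show "0 \<le> s t" for t using d[of t] by (simp add: s_def f_def)
    show "s t \<le> 1" for t using d[of t] by (simp add: s_def d_def f_def)
    show "s t = 0" if "t \<le> 0" for t using that by (simp add: s_def f_def)
    show "s t = 1" if "1 \<le> t" for t using that d[of t] by (auto simp: s_def d_def f_def)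
  qed auto
qed

definition ball_cutoff :: "real \<Rightarrow> real \<Rightarrow> (real ^ 'n::finite \<Rightarrow> real) \<Rightarrow> (real ^ 'n \<Rightarrow> real ^ 'n) \<Rightarrow> bool" where
  "ball_cutoff K R \<eta> G \<longleftrightarrow> C1_grad \<eta> G \<and> (\<forall>x. 0 \<le> \<eta> x \<and> \<eta> x \<le> 1) \<and>
     (\<forall>x. norm x \<le> R \<longrightarrow> \<eta> x = 1) \<and> (\<forall>x. 2 * R \<le> norm x \<longrightarrow> \<eta> x = 0) \<and>
     (\<forall>x. G x \<noteq> 0 \<longrightarrow> R \<le> norm x \<and> norm x \<le> 2 * R) \<and> (\<forall>x. norm (G x) \<le> K / R)"

text \<open>
  A step function of \<open>(|x|\<^sup>2 / R\<^sup>2 - 1) / 3\<close>, which runs from \<open>0\<close> to \<open>1\<close> between the spheres of radius \<open>R\<close>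
  and \<open>2R\<close>; squaring the norm avoids its singularity at the origin. By scaling, one constant \<open>K\<close>
  serves all radii.
\<close>

lemma ball_cutoff_exists:
  "\<exists>K\<ge>0. \<forall>R>0. \<exists>(\<eta> :: real ^ 'n::finite \<Rightarrow> real) G. ball_cutoff K R \<eta> G"
proof -
  obtain s s' K where s: "\<And>t. (s has_real_derivative s' t) (at t)" "continuous_on UNIV s'"
    "\<And>t. 0 \<le> s t" "\<And>t. s t \<le> 1" "\<And>t. t \<le> 0 \<Longrightarrow> s t = 0" "\<And>t. 1 \<le> t \<Longrightarrow> s t = 1"
    "\<And>t. t \<le> 0 \<or> 1 \<le> t \<Longrightarrow> s' t = 0" "\<And>t. \<bar>s' t\<bar> \<le> K"
    by (rule C1_step_function) blast
  have K0: "K \<ge> 0" using s(8)[of 0] by simp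
  have "\<exists>(\<eta> :: real ^ 'n \<Rightarrow> real) G. ball_cutoff (2 * K) R \<eta> G" if R: "R > 0" for R
  proof -
    define c where "c = 1 / (3 * R\<^sup>2)"
    define \<tau> where "\<tau> x = c * (norm x)\<^sup>2 - 1 / 3" for x :: "real ^ 'n"
    define \<eta> where "\<eta> x = 1 - s (\<tau> x)" for x
    define G where "G x = - s' (\<tau> x) *\<^sub>R ((2 * c) *\<^sub>R x)" for x
    have \<tau>: "C1_grad \<tau> (\<lambda>x. (2 * c) *\<^sub>R x)"
      unfolding \<tau>_def dot_square_norm[symmetric]
      by (rule C1_gradI) (auto intro!: derivative_eq_intros continuous_intros simp: fun_eq_iff inner_commute algebra_simps)
    have \<tau>0: "\<tau> x \<le> 0 \<longleftrightarrow> norm x \<le> R" for x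
      using R by (simp add: \<tau>_def c_def field_simps abs_le_square_iff[symmetric])
    have \<tau>1: "1 \<le> \<tau> x \<longleftrightarrow> 2 * R \<le> norm x" for x
      using R abs_le_square_iff[of "2 * R" "norm x"] by (simp add: \<tau>_def c_def field_simps power_mult_distrib)
    have \<eta>: "C1_grad \<eta> G"
      unfolding \<eta>_def[abs_def] G_def[abs_def]
      by (rule C1_grad_compose[OF \<tau>, of "\<lambda>t. 1 - s t" "\<lambda>t. - s' t"])
         (auto intro!: derivative_eq_intros s(1) continuous_intros continuous_on_compose2[OF s(2)]
            C1_grad_continuous[OF \<tau>])
    have Gsupp: "R \<le> norm x \<and> norm x \<le> 2 * R" if "G x \<noteq> 0" for x
    proof -
      have "\<not> (\<tau> x \<le> 0 \<or> 1 \<le> \<tau> x)" using that s(7) by (auto simp: G_def)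
      then show ?thesis by (simp add: \<tau>0 \<tau>1)
    qed
    have "norm (G x) \<le> 2 * K / R" for x
    proof (cases "G x = 0")
      case False
      have "norm (G x) = \<bar>s' (\<tau> x)\<bar> * (2 * c * norm x)" using R by (simp add: G_def c_def abs_mult)
      also have "\<dots> \<le> K * (2 * c * (2 * R))"
        using Gsupp[OF False] K0 R unfolding c_def by (intro mult_mono s mult_left_mono) auto
      also have "\<dots> = 4 / 3 * (K / R)" using R by (simp add: c_def power2_eq_square field_simps)
      also have "\<dots> \<le> 2 * (K / R)" using K0 R by (intro mult_right_mono) auto
      finally show ?thesis by simp
    qed (use K0 R in simp)
    then show ?thesis
      using \<eta> Gsupp s by (intro exI[of _ \<eta>] exI[of _ G]) (auto simp: ball_cutoff_def \<eta>_def \<tau>0 \<tau>1)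
  qed
  then show ?thesis using K0 by (intro exI[of _ "2 * K"]) auto
qed

section \<open>Two auxiliary inequalities\<close>

text \<open>
  Young's inequality in the form that absorbs \<open>u\<^sup>2 |\<nabla>\<eta>|\<^sup>2\<close> for \<open>\<eta> = s\<^bsup>k+1\<^esup>\<close> and \<open>t = u\<close>. Either the first
  term on the right dominates, or \<open>s\<^sup>2 t\<^bsup>p-1\<^esup> < \<kappa>/\<mu>\<close>, and then the second one does. The loss of a factor
  \<open>s\<close> in the gradient is harmless because \<open>k\<close> is large.
\<close>

lemma weighted_young:
  fixes s t :: real
  assumes p: "p > 1" and k: "2 / (p - 1) \<le> real k" and s: "0 \<le> s" "s \<le> 1" and t: "0 < t"
    and \<kappa>: "0 < \<kappa>" and mu: "0 < \<mu>"
  shows "\<kappa> * (s ^ k)\<^sup>2 * t\<^sup>2 \<le> \<mu> * (t powr (p + 1) * (s ^ (k + 1))\<^sup>2) + \<kappa> * (\<kappa> / \<mu>) powr (2 / (p - 1))"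
proof (cases "s = 0")
  case True
  have "0 < 2 / (p - 1)" using p by simp
  then have "k > 0" using k by (cases k) auto
  then show ?thesis using True \<kappa> mu by (simp add: zero_power)
next
  case False
  with s have s: "0 < s" "s \<le> 1" by auto
  have tp: "t powr (p + 1) = t powr (p - 1) * t\<^sup>2"
    using t powr_add[of t "p - 1" 2] by (simp add: add.commute)
  show ?thesis
  proof (cases "\<kappa> \<le> \<mu> * (s\<^sup>2 * t powr (p - 1))")
    case True
    then have "\<kappa> * ((s ^ k)\<^sup>2 * t\<^sup>2) \<le> \<mu> * (s\<^sup>2 * t powr (p - 1)) * ((s ^ k)\<^sup>2 * t\<^sup>2)"
      by (intro mult_right_mono) auto
    also have "\<dots> = \<mu> * (t powr (p + 1) * (s ^ (k + 1))\<^sup>2)"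
      by (simp add: tp power_mult_distrib mult_ac)
    finally show ?thesis using \<kappa> by (simp add: mult.assoc add_increasing2)
  next
    case False
    have "(s ^ k)\<^sup>2 * t\<^sup>2 \<le> s powr (2 * (2 / (p - 1))) * t\<^sup>2"
    proof (intro mult_right_mono)
      have "(s ^ k)\<^sup>2 = s powr (2 * real k)"
        using s by (simp add: powr_realpow[symmetric] powr_powr mult.commute flip: powr_numeral)
      also have "\<dots> \<le> s powr (2 * (2 / (p - 1)))"
        using s k by (intro powr_mono') auto
      finally show "(s ^ k)\<^sup>2 \<le> s powr (2 * (2 / (p - 1)))" .
    qed simp
    also have "\<dots> = (s\<^sup>2 * t powr (p - 1)) powr (2 / (p - 1))"
    proof -
      have "(t powr (p - 1)) powr (2 / (p - 1)) = t powr ((p - 1) * (2 / (p - 1)))" by (rule powr_powr)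
      also have "(p - 1) * (2 / (p - 1)) = 2" using p by (simp add: field_simps)
      finally have "(t powr (p - 1)) powr (2 / (p - 1)) = t\<^sup>2" using t by simp
      moreover have "(s powr 2) powr (2 / (p - 1)) = s powr (2 * (2 / (p - 1)))" by (rule powr_powr)
      ultimately show ?thesis using s by (simp add: powr_mult)
    qed
    also have "\<dots> \<le> (\<kappa> / \<mu>) powr (2 / (p - 1))"
      using False mu p by (intro powr_mono2) (auto simp: field_simps)
    finally have "\<kappa> * ((s ^ k)\<^sup>2 * t\<^sup>2) \<le> \<kappa> * (\<kappa> / \<mu>) powr (2 / (p - 1))"
      using \<kappa> by (intro mult_left_mono) auto
    then show ?thesis using mu by (simp add: mult.assoc add_increasing)
  qed
qed

lemma integral_pos_continuous:
  fixes f :: "real ^ 'n::finite \<Rightarrow> real"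
  assumes "continuous_on UNIV f" "\<And>x. 0 \<le> f x" "\<And>x. r < norm x \<Longrightarrow> f x = 0" "0 < f y"
  shows "0 < (LINT x|lborel. f x)"
proof (rule ccontr)
  have I: "integrable lborel f" by (rule integrable_compactly_supported[OF assms(1,3)])
  assume "\<not> ?thesis"
  then have "(LINT x|lborel. f x) = 0"
    using Bochner_Integration.integral_nonneg[of lborel f] assms(2) by (simp add: order_antisym)
  then have "AE x in lborel. f x = 0"
    using integral_nonneg_eq_0_iff_AE[OF I] assms(2) by simp
  moreover have op: "open {x. f x \<noteq> 0}"
    by (rule open_Collect_neq[OF assms(1) continuous_on_const])
  ultimately have "{x. f x \<noteq> 0} \<in> null_sets lborel"
    using AE_iff_null[of lborel "\<lambda>x. f x = 0"] by simp
  then have "negligible {x. f x \<noteq> 0}"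
    unfolding negligible_iff_null_sets by (rule null_sets_completionI)
  moreover have "{x. f x \<noteq> 0} \<noteq> {}" using assms(4) by (metis (mono_tags) empty_iff less_irrefl mem_Collect_eq)
  ultimately show False using open_not_negligible[OF op] by blast
qed

section \<open>Decay of the energy on annuli\<close>

context henon_solution
begin

text \<open>
  Testing stability with \<open>u \<eta>\<close> and the equation with \<open>u \<eta>\<^sup>2\<close> produces the same quadratic expression in
  \<open>\<nabla>u\<close>, up to \<open>u\<^sup>2 |\<nabla>\<eta>|\<^sup>2\<close>. Its elimination leaves the factor \<open>p - 1 > 0\<close>.
\<close>

lemma stability_inequality:
  assumes st: "stable_outside a p u r" and \<eta>: "C1_grad \<eta> G"
    and in0: "\<And>x. norm x < r \<Longrightarrow> \<eta> x = 0" and out0: "\<And>x. s < norm x \<Longrightarrow> \<eta> x = 0"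
  shows "(p - 1) * (LINT x|lborel. E x * (\<eta> x)\<^sup>2) \<le> (LINT x|lborel. (u x)\<^sup>2 * (norm (G x))\<^sup>2)" (is ?A)
    and "(LINT x|lborel. (norm (u x *\<^sub>R G x + \<eta> x *\<^sub>R U x))\<^sup>2)
      = (LINT x|lborel. E x * (\<eta> x)\<^sup>2) + (LINT x|lborel. (u x)\<^sup>2 * (norm (G x))\<^sup>2)" (is ?B)
proof -
  have G0: "G x = 0" if "s < norm x" for x by (rule C1_grad_eq_0_outside[OF \<eta> out0 that])
  note cont = continuous_intros continuous_u continuous_E C1_grad_continuous[OF \<eta>] C1_gradD(1)[OF \<eta>] C1_gradD(1)[OF U]
  have I: "integrable lborel (\<lambda>x. E x * (\<eta> x)\<^sup>2)" "integrable lborel (\<lambda>x. (u x)\<^sup>2 * (norm (G x))\<^sup>2)"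
    "integrable lborel (\<lambda>x. (\<eta> x)\<^sup>2 * (norm (U x))\<^sup>2)" "integrable lborel (\<lambda>x. 2 * u x * \<eta> x * (G x \<bullet> U x))"
    by (rule integrable_compactly_supported[where r=s]; auto simp: out0 G0 intro!: cont)+
  have \<phi>: "C1_grad (\<lambda>x. u x * \<eta> x) (\<lambda>x. u x *\<^sub>R G x + \<eta> x *\<^sub>R U x)" by (rule C1_grad_mult[OF U \<eta>])
  have sq: "(norm (u x *\<^sub>R G x + \<eta> x *\<^sub>R U x))\<^sup>2
      = (\<eta> x)\<^sup>2 * (norm (U x))\<^sup>2 + 2 * u x * \<eta> x * (G x \<bullet> U x) + (u x)\<^sup>2 * (norm (G x))\<^sup>2" for x
    unfolding power2_norm_eq_inner
    by (simp add: inner_add_left inner_add_right inner_commute power2_eq_square algebra_simps)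
  have "(LINT x|lborel. (\<eta> x * \<eta> x) * (\<Sum>i\<in>UNIV. energy_field_grad i x $ i))
      = - (LINT x|lborel. (\<Sum>i\<in>UNIV. (\<eta> x *\<^sub>R G x + \<eta> x *\<^sub>R G x) $ i * energy_field i x))"
    by (rule integral_by_parts_div[OF C1_grad_mult[OF \<eta> \<eta>] _ C1_grad_energy_field, where r=s]) (simp add: out0)
  moreover have "(\<eta> x * \<eta> x) * (\<Sum>i\<in>UNIV. energy_field_grad i x $ i)
      = (\<eta> x)\<^sup>2 * (norm (U x))\<^sup>2 - E x * (\<eta> x)\<^sup>2" for x
    by (simp add: div_energy_field power2_eq_square algebra_simps)
  moreover have "(\<Sum>i\<in>UNIV. (\<eta> x *\<^sub>R G x + \<eta> x *\<^sub>R G x) $ i * energy_field i x) = 2 * u x * \<eta> x * (G x \<bullet> U x)" for x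
    by (simp add: energy_field_def inner_vec_def sum_distrib_left algebra_simps)
  ultimately have parts: "(LINT x|lborel. (\<eta> x)\<^sup>2 * (norm (U x))\<^sup>2) - (LINT x|lborel. E x * (\<eta> x)\<^sup>2)
      = - (LINT x|lborel. 2 * u x * \<eta> x * (G x \<bullet> U x))"
    using I by simp
  show B: ?B
    unfolding sq using I parts by simp
  have "(\<lambda>x. u x * \<eta> x) \<in> C1c" by (rule C1cI[OF \<phi>, of s]) (simp add: out0)
  then have I0: "0 \<le> I_uu a p u (\<lambda>x. u x * \<eta> x)" using st in0 by (simp add: stable_outside_def)
  have E: "norm_pow a x * u x powr (p - 1) * (u x * \<eta> x)\<^sup>2 = E x * (\<eta> x)\<^sup>2" for x
  proof -
    have "u x powr (p + 1) = u x powr (p - 1) * (u x)\<^sup>2"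
      using pos[of x] powr_add[of "u x" "p - 1" 2] by (simp add: add.commute)
    then show ?thesis by (simp add: E_def power_mult_distrib mult_ac)
  qed
  show ?A using I0 unfolding I_uu_def C1_grad_grad[OF \<phi>] E B by (simp add: algebra_simps)
qed

text \<open>
  The integrand is estimated through a majorant \<open>A\<close> defined on the whole space rather than integrated
  over the annulus: the majorant is made of the test function expressions of the stability inequality,
  whose integrals are known.
\<close>

lemma annulus_energy_decay:
  assumes st: "stable_outside a p u r"
  shows "\<exists>C\<ge>0. \<exists>R0\<ge>1. \<forall>R\<ge>R0. \<exists>A. integrable lborel A \<and> (\<forall>x. 0 \<le> A x) \<and>
    (\<forall>x. R \<le> norm x \<and> norm x \<le> 2 * R \<longrightarrow> E x + (norm (U x))\<^sup>2 + (u x)\<^sup>2 / R\<^sup>2 \<le> A x) \<and>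
    integral\<^sup>L lborel A \<le> C * R powr (N - 2 - (2 + a) * (2 / (p - 1)))"
proof -
  obtain K where K: "K \<ge> 0" "\<And>R. R > 0 \<Longrightarrow> \<exists>(\<eta> :: real ^ 'n \<Rightarrow> real) G. ball_cutoff K R \<eta> G"
    using ball_cutoff_exists by blast
  define q where "q = 2 / (p - 1)"
  have q: "q > 0" using p by (simp add: q_def)
  obtain k :: nat where k: "q \<le> real k" using real_arch_simple by blast
  \<comment> \<open>Since \<open>(k+1) 3K/R\<close> bounds the gradient of the test function up to the factor \<open>\<psi>\<^sup>k\<close>, the square of
    that gradient is at most \<open>K0/R\<^sup>2 (\<psi>\<^sup>k)\<^sup>2\<close>. The summand \<open>1\<close> lets the same constant control \<open>u\<^sup>2/R\<^sup>2\<close>.\<close>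
  define K0 where "K0 = (real (k + 1) * (3 * K))\<^sup>2 + 1"
  have K0: "K0 \<ge> 1" by (simp add: K0_def)
  define vol where "vol = unit_ball_vol N"
  have vol: "vol \<ge> 0" by (simp add: vol_def N)
  \<comment> \<open>Half of the factor in the stability inequality is spent on absorbing the gradient term.\<close>
  define c where "c = (p - 1) / 2"
  have c: "c > 0" using p by (simp add: c_def)
  define M0 where "M0 = K0 * (K0 * 2 powr a / c) powr q * (vol * 4 powr N)"
  have M0: "M0 \<ge> 0" using K0 vol by (simp add: M0_def)
  define C where "C = ((1 + c) / c + 2 * (1 / c + 2) + 5) * M0"
  have C: "C \<ge> 0" using M0 c by (simp add: C_def)
  have "\<exists>A. integrable lborel A \<and> (\<forall>x. 0 \<le> A x) \<and>
      (\<forall>x. R \<le> norm x \<and> norm x \<le> 2 * R \<longrightarrow> E x + (norm (U x))\<^sup>2 + (u x)\<^sup>2 / R\<^sup>2 \<le> A x) \<and>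
      integral\<^sup>L lborel A \<le> C * R powr (N - 2 - (2 + a) * q)" if R: "R \<ge> max 1 (2 * r)" for R
  proof -
    have R1: "R \<ge> 1" "R > 0" "r \<le> R / 2" using R by auto
    obtain \<eta>1 G1 where 1: "ball_cutoff K (R / 2) (\<eta>1 :: real ^ 'n \<Rightarrow> real) G1" using K(2)[of "R / 2"] R1 by auto
    obtain \<eta>2 G2 where 2: "ball_cutoff K (2 * R) (\<eta>2 :: real ^ 'n \<Rightarrow> real) G2" using K(2)[of "2 * R"] R1 by auto
    \<comment> \<open>A cutoff to the annulus: \<open>1\<close> for \<open>R \<le> |x| \<le> 2R\<close>, and \<open>0\<close> unless \<open>R/2 < |x| < 4R\<close>.\<close>
    define \<psi> where "\<psi> x = (1 - \<eta>1 x) * \<eta>2 x" for x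
    define \<Psi> where "\<Psi> x = (1 - \<eta>1 x) *\<^sub>R G2 x + \<eta>2 x *\<^sub>R (0 - G1 x)" for x
    have \<psi>: "C1_grad \<psi> \<Psi>"
      unfolding \<psi>_def[abs_def] \<Psi>_def[abs_def]
      using 1 2 by (intro C1_grad_mult C1_grad_diff C1_grad_const) (auto simp: ball_cutoff_def)
    have \<psi>01: "0 \<le> \<psi> x" "\<psi> x \<le> 1" for x
      using 1 2 by (auto simp: \<psi>_def ball_cutoff_def intro!: mult_le_one)
    have \<psi>in: "\<psi> x = 0" if "norm x \<le> R / 2" for x using that 1 by (simp add: \<psi>_def ball_cutoff_def)
    have \<psi>out: "\<psi> x = 0" if "4 * R \<le> norm x" for x using that 2 by (simp add: \<psi>_def ball_cutoff_def)
    have \<psi>1: "\<psi> x = 1" if "R \<le> norm x" "norm x \<le> 2 * R" for x using that 1 2 by (simp add: \<psi>_def ball_cutoff_def)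
    have \<Psi>: "norm (\<Psi> x) \<le> 3 * K / R" for x
    proof -
      have *: "0 \<le> \<eta>1 x" "\<eta>1 x \<le> 1" "0 \<le> \<eta>2 x" "\<eta>2 x \<le> 1" using 1 2 by (auto simp: ball_cutoff_def)
      have "norm (\<Psi> x) \<le> norm ((1 - \<eta>1 x) *\<^sub>R G2 x) + norm (\<eta>2 x *\<^sub>R (0 - G1 x))"
        unfolding \<Psi>_def by (rule norm_triangle_ineq)
      also have "\<dots> = (1 - \<eta>1 x) * norm (G2 x) + \<eta>2 x * norm (G1 x)" using * by simp
      also have "\<dots> \<le> norm (G2 x) + norm (G1 x)"
        using * by (intro add_mono mult_left_le_one_le) auto
      also have "\<dots> \<le> K / (2 * R) + K / (R / 2)" using 1 2 by (intro add_mono) (auto simp: ball_cutoff_def)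
      also have "\<dots> \<le> 3 * K / R" using K(1) R1 by (simp add: field_simps)
      finally show ?thesis .
    qed
    define \<eta> where "\<eta> x = \<psi> x ^ (k + 1)" for x
    define G where "G x = (real (k + 1) * \<psi> x ^ k) *\<^sub>R \<Psi> x" for x
    have \<eta>: "C1_grad \<eta> G"
      unfolding \<eta>_def[abs_def] G_def[abs_def]
      by (rule C1_grad_compose[OF \<psi>, of "\<lambda>t. t ^ (k + 1)" "\<lambda>t. real (k + 1) * t ^ k"])
         (use DERIV_pow[of "k + 1"] in \<open>auto intro!: continuous_intros C1_grad_continuous[OF \<psi>]\<close>)
    have \<eta>in: "\<eta> x = 0" if "norm x \<le> R / 2" for x using that by (simp add: \<eta>_def \<psi>in)
    have \<eta>out: "\<eta> x = 0" if "4 * R < norm x" for x using that by (simp add: \<eta>_def \<psi>out)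
    have \<eta>1: "\<eta> x = 1" if "R \<le> norm x" "norm x \<le> 2 * R" for x using that by (simp add: \<eta>_def \<psi>1)
    have Gin: "G x = 0" if "norm x < R / 2" for x
      by (rule C1_grad_eq_0[OF \<eta>, of "ball 0 (R / 2)"]) (use that \<eta>in in auto)
    have Gout: "G x = 0" if "4 * R < norm x" for x by (rule C1_grad_eq_0_outside[OF \<eta> \<eta>out that])
    define \<kappa> where "\<kappa> = K0 / R\<^sup>2"
    \<comment> \<open>On the support of the test function the weight is at least \<open>(R/2)\<^sup>a\<close>.\<close>
    define lam where "lam = c * (R / 2) powr a"
    define T where "T = \<kappa> * (\<kappa> / lam) powr q"
    have kl: "\<kappa> > 0" "lam > 0" using K0 R1 c by (auto simp: \<kappa>_def lam_def)
    have T: "T \<ge> 0" using kl by (simp add: T_def)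
    have lamE: "lam * u x powr (p + 1) \<le> c * E x" if "R / 2 \<le> norm x" for x
      using norm_pow_mono[OF a _ that] R1 c by (simp add: lam_def E_def mult_right_mono)
    have young: "\<kappa> * (s ^ k)\<^sup>2 * (u x)\<^sup>2 \<le> lam * (u x powr (p + 1) * (s ^ (k + 1))\<^sup>2) + T"
      if "0 \<le> s" "s \<le> 1" for s x
      unfolding T_def q_def by (rule weighted_young[OF p _ that pos kl]) (use k q_def in simp)
    have G2: "(norm (G x))\<^sup>2 \<le> \<kappa> * (\<psi> x ^ k)\<^sup>2" for x
    proof -
      have "norm (G x) = real (k + 1) * \<psi> x ^ k * norm (\<Psi> x)"
        unfolding G_def using \<psi>01[of x] by simp
      also have "\<dots> \<le> real (k + 1) * \<psi> x ^ k * (3 * K / R)"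
        using \<psi>01[of x] by (intro mult_left_mono \<Psi>) simp
      finally have "norm (G x) \<le> real (k + 1) * \<psi> x ^ k * (3 * K / R)" .
      then have "(norm (G x))\<^sup>2 \<le> (real (k + 1) * \<psi> x ^ k * (3 * K / R))\<^sup>2" by (intro power_mono) auto
      also have "\<dots> = (real (k + 1) * (3 * K))\<^sup>2 / R\<^sup>2 * (\<psi> x ^ k)\<^sup>2"
        by (simp add: power_mult_distrib power_divide)
      also have "\<dots> \<le> \<kappa> * (\<psi> x ^ k)\<^sup>2"
        unfolding \<kappa>_def K0_def by (intro mult_right_mono divide_right_mono) auto
      finally show ?thesis .
    qed
    let ?B = "indicator (cball (0 :: real ^ 'n) (4 * R)) :: real ^ 'n \<Rightarrow> real"
    have pw: "(u x)\<^sup>2 * (norm (G x))\<^sup>2 \<le> c * (E x * (\<eta> x)\<^sup>2) + T * ?B x" for x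
    proof (cases "R / 2 \<le> norm x \<and> norm x \<le> 4 * R")
      case True
      have "(u x)\<^sup>2 * (norm (G x))\<^sup>2 \<le> (u x)\<^sup>2 * (\<kappa> * (\<psi> x ^ k)\<^sup>2)" by (intro mult_left_mono G2) simp
      also have "\<dots> = \<kappa> * (\<psi> x ^ k)\<^sup>2 * (u x)\<^sup>2" by simp
      also have "\<dots> \<le> lam * u x powr (p + 1) * (\<eta> x)\<^sup>2 + T"
        using young[OF \<psi>01[of x], of x] by (simp add: \<eta>_def mult.assoc)
      also have "\<dots> \<le> c * E x * (\<eta> x)\<^sup>2 + T"
        using lamE True by (intro add_right_mono mult_right_mono) auto
      finally show ?thesis using True by (simp add: mult.assoc)
    next
      case False
      then have "norm x < R / 2 \<or> 4 * R < norm x" by auto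
      then have "G x = 0" using Gin Gout by blast
      then show ?thesis using E_nonneg[of x] T c by simp
    qed
    note cont = continuous_intros continuous_u continuous_E C1_grad_continuous[OF \<eta>] C1_gradD(1)[OF \<eta>] C1_gradD(1)[OF U]
    have I: "integrable lborel (\<lambda>x. E x * (\<eta> x)\<^sup>2)" "integrable lborel (\<lambda>x. (u x)\<^sup>2 * (norm (G x))\<^sup>2)"
      "integrable lborel (\<lambda>x. (norm (u x *\<^sub>R G x + \<eta> x *\<^sub>R U x))\<^sup>2)"
      by (rule integrable_compactly_supported[where r="4 * R"]; auto simp: \<eta>out Gout intro!: cont)+
    have IB: "integrable lborel (\<lambda>x. T * ?B x)"
      by (intro integrable_mult_right integrable_real_indicator)
         (use emeasure_lborel_cball_finite[of "0::real^'n" "4*R"] in \<open>auto simp: less_top\<close>)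
    \<comment> \<open>Absorption: \<open>2 c J \<le> L \<le> c J + M\<close> bounds both \<open>J\<close> and \<open>L\<close> by the remainder \<open>M\<close>.\<close>
    define J where "J = (LINT x|lborel. E x * (\<eta> x)\<^sup>2)"
    define L where "L = (LINT x|lborel. (u x)\<^sup>2 * (norm (G x))\<^sup>2)"
    define W where "W = (LINT x|lborel. (norm (u x *\<^sub>R G x + \<eta> x *\<^sub>R U x))\<^sup>2)"
    define M where "M = (LINT x|lborel. T * ?B x)"
    have "L \<le> (LINT x|lborel. c * (E x * (\<eta> x)\<^sup>2) + T * ?B x)"
      unfolding L_def by (rule integral_mono[OF I(2) _ pw]) (intro Bochner_Integration.integrable_add IB integrable_mult_right I)
    also have "\<dots> = c * J + M" unfolding J_def M_def using I IB by simp
    finally have L1: "L \<le> c * J + M" .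
    have JL: "2 * c * J \<le> L" "W = J + L"
    proof -
      have c2: "2 * c = p - 1" by (simp add: c_def)
      have "\<eta> x = 0" if "norm x < r" for x using \<eta>in that R1 by auto
      note * = stability_inequality[OF st \<eta> this \<eta>out]
      show "2 * c * J \<le> L" "W = J + L" unfolding c2 J_def L_def W_def using * by auto
    qed
    have J: "J \<le> M / c" using L1 JL c by (simp add: field_simps)
    have L: "L \<le> 2 * M" using L1 JL by simp
    have M_eq: "M = M0 * R powr (N - 2 - (2 + a) * q)"
    proof -
      have inv2: "R powr (- 2) = 1 / R\<^sup>2"
        using R1 powr_minus[of R 2] by (simp add: inverse_eq_divide)
      have "R powr (- (2 + a)) = R powr (- 2) * R powr (- a)"
        by (subst powr_add[symmetric]) simp
      then have inva: "R powr (- (2 + a)) = 1 / (R\<^sup>2 * R powr a)"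
        using R1 unfolding inv2 powr_minus by (simp add: inverse_eq_divide)
      have "\<kappa> / lam = (K0 * 2 powr a / c) * R powr (- (2 + a))"
        unfolding inva \<kappa>_def lam_def using R1 c by (simp add: powr_divide)
      then have "(\<kappa> / lam) powr q = (K0 * 2 powr a / c) powr q * R powr (- (2 + a) * q)"
        by (simp only: powr_mult powr_powr)
      then have T_eq: "T = K0 * R powr (- 2) * ((K0 * 2 powr a / c) powr q * R powr (- (2 + a) * q))"
        unfolding T_def \<kappa>_def inv2 by simp
      have "measure lborel (cball (0 :: real ^ 'n) (4 * R)) = vol * (4 powr N * R powr N)"
        using R1 by (simp add: content_cball vol_def N power_mult_distrib powr_realpow)
      then have "M = M0 * (R powr (- 2) * R powr (- (2 + a) * q) * R powr N)"
        unfolding M_def M0_def T_eq by simp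
      also have "R powr (- 2) * R powr (- (2 + a) * q) * R powr N = R powr (- 2 + - (2 + a) * q + N)"
        by (simp only: powr_add)
      also have "- 2 + - (2 + a) * q + N = N - 2 - (2 + a) * q" by (simp add: algebra_simps)
      finally show ?thesis .
    qed
    define A where "A x = (1 + c) * (E x * (\<eta> x)\<^sup>2) + 2 * (norm (u x *\<^sub>R G x + \<eta> x *\<^sub>R U x))\<^sup>2
      + 2 * ((u x)\<^sup>2 * (norm (G x))\<^sup>2) + T * ?B x" for x
    have IA: "integrable lborel A"
      unfolding A_def[abs_def] by (intro Bochner_Integration.integrable_add IB integrable_mult_right I)
    have A0: "0 \<le> A x" for x using E_nonneg[of x] T c by (simp add: A_def)
    have AE: "E x + (norm (U x))\<^sup>2 + (u x)\<^sup>2 / R\<^sup>2 \<le> A x" if x: "R \<le> norm x" "norm x \<le> 2 * R" for x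
    proof -
      have B: "?B x = 1" using x R1 by simp
      have "(norm (U x))\<^sup>2 \<le> 2 * (norm (u x *\<^sub>R G x + U x))\<^sup>2 + 2 * ((u x)\<^sup>2 * (norm (G x))\<^sup>2)"
      proof -
        have "norm (U x) \<le> norm (u x *\<^sub>R G x + U x) + norm (u x *\<^sub>R G x)"
          using norm_triangle_ineq4[of "u x *\<^sub>R G x + U x" "u x *\<^sub>R G x"] by simp
        then have "(norm (U x))\<^sup>2 \<le> (norm (u x *\<^sub>R G x + U x) + norm (u x *\<^sub>R G x))\<^sup>2" by (intro power_mono) auto
        also have "\<dots> \<le> 2 * (norm (u x *\<^sub>R G x + U x))\<^sup>2 + 2 * (norm (u x *\<^sub>R G x))\<^sup>2"
          unfolding power2_sum
          using sum_squares_bound[of "norm (u x *\<^sub>R G x + U x)" "norm (u x *\<^sub>R G x)"] by linarith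
        finally show ?thesis by (simp add: power_mult_distrib)
      qed
      moreover have "(u x)\<^sup>2 / R\<^sup>2 \<le> c * E x + T"
      proof -
        have "1 / R\<^sup>2 \<le> \<kappa>" unfolding \<kappa>_def using K0 by (intro divide_right_mono) auto
        then have "(u x)\<^sup>2 / R\<^sup>2 \<le> \<kappa> * (u x)\<^sup>2"
          using mult_right_mono[of "1 / R\<^sup>2" \<kappa> "(u x)\<^sup>2"] by simp
        also have "\<dots> \<le> lam * u x powr (p + 1) + T" using young[of 1 x] by simp
        also have "\<dots> \<le> c * E x + T" using lamE[of x] x R1 by simp
        finally show ?thesis .
      qed
      ultimately show ?thesis using B \<eta>1[OF x] by (simp add: A_def algebra_simps)
    qed
    have "integral\<^sup>L lborel A = (1 + c) * J + 2 * W + 2 * L + M"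
      unfolding A_def[abs_def] J_def W_def L_def M_def using I IB by simp
    also have "\<dots> \<le> (1 + c) * (M / c) + 2 * (M / c + 2 * M) + 2 * (2 * M) + M"
      using J L JL(2) c by (intro add_mono mult_left_mono) auto
    also have "\<dots> = C * R powr (N - 2 - (2 + a) * q)"
      unfolding C_def M_eq by (simp add: algebra_simps)
    finally show ?thesis using IA A0 AE by blast
  qed
  then show ?thesis
    unfolding q_def using C by (intro exI[of _ C] conjI exI[of _ "max 1 (2 * r)"]) auto
qed

section \<open>Nonexistence\<close>

text \<open>
  By the Pohozaev identity the energy in the ball of radius \<open>R\<close> is controlled by the energy on the
  annulus where the gradient of the cutoff lives. The latter tends to \<open>0\<close>, while the former is bounded
  below by the energy \<open>c0\<close> near the unit ball.
\<close>

lemma not_stable_outside: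
  assumes N3: "N > 2" and sub: "p < (N + 2 + 2 * a) / (N - 2)"
  shows "\<not> stable_outside a p u r"
proof
  assume st: "stable_outside a p u r"
  define e where "e = N - 2 - (2 + a) * (2 / (p - 1))"
  define \<delta> where "\<delta> = (N + a) / (p + 1) - (N - 2) / 2"
  have sub': "p * (N - 2) < N + 2 + 2 * a" using sub N3 by (simp add: less_divide_eq)
  have e: "e < 0" unfolding e_def using sub' p by (simp add: field_simps)
  have \<delta>: "\<delta> > 0" unfolding \<delta>_def using sub' p by (simp add: field_simps)
  obtain C R0 where C: "C \<ge> 0" "R0 \<ge> 1" and CA: "\<And>R. R \<ge> R0 \<Longrightarrow> \<exists>A. integrable lborel A \<and> (\<forall>x. 0 \<le> A x) \<and>
    (\<forall>x. R \<le> norm x \<and> norm x \<le> 2 * R \<longrightarrow> E x + (norm (U x))\<^sup>2 + (u x)\<^sup>2 / R\<^sup>2 \<le> A x) \<and>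
    integral\<^sup>L lborel A \<le> C * R powr e"
    using annulus_energy_decay[OF st] unfolding e_def by blast
  obtain K where K: "K \<ge> 0" "\<And>R. R > 0 \<Longrightarrow> \<exists>(\<eta> :: real ^ 'n \<Rightarrow> real) G. ball_cutoff K R \<eta> G"
    using ball_cutoff_exists by blast
  obtain \<eta>1 G1 where 1: "ball_cutoff K 1 (\<eta>1 :: real ^ 'n \<Rightarrow> real) G1" using K(2)[of 1] by auto
  have \<eta>1: "C1_grad \<eta>1 G1" using 1 by (simp add: ball_cutoff_def)
  define c0 where "c0 = (LINT x|lborel. \<eta>1 x * E x)"
  obtain e1 :: "real ^ 'n" where e1: "norm e1 = 1" using vector_choose_size[of 1] by auto
  have e1': "e1 \<noteq> 0" using e1 by auto
  have c0: "c0 > 0"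
    unfolding c0_def
  proof (rule integral_pos_continuous[where r=2 and y=e1])
    show "continuous_on UNIV (\<lambda>x. \<eta>1 x * E x)"
      by (intro continuous_intros continuous_E C1_grad_continuous[OF \<eta>1])
    show "0 < \<eta>1 e1 * E e1"
      using e1' e1 1 pos[of e1] norm_pow_pos[of e1 a] by (simp add: ball_cutoff_def E_def)
  qed (use 1 E_nonneg in \<open>auto simp: ball_cutoff_def\<close>)
  have bound: "\<delta> * c0 \<le> K * (N + 3) * C * R powr e" if R: "R \<ge> max 2 R0" for R
  proof -
    have R2: "R \<ge> 2" "R > 0" "R \<ge> R0" using R by auto
    obtain \<eta> G where cut: "ball_cutoff K R (\<eta> :: real ^ 'n \<Rightarrow> real) G" using K(2)[of R] R2 by auto
    have \<eta>: "C1_grad \<eta> G" and out: "\<And>x. 2 * R < norm x \<Longrightarrow> \<eta> x = 0" using cut by (auto simp: ball_cutoff_def)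
    obtain A where A: "integrable lborel A" "\<And>x. 0 \<le> A x"
      "\<And>x. R \<le> norm x \<and> norm x \<le> 2 * R \<Longrightarrow> E x + (norm (U x))\<^sup>2 + (u x)\<^sup>2 / R\<^sup>2 \<le> A x"
      "integral\<^sup>L lborel A \<le> C * R powr e"
      using CA[OF R2(3)] by blast
    have "c0 \<le> (LINT x|lborel. \<eta> x * E x)"
      unfolding c0_def
    proof (rule integral_mono)
      show "integrable lborel (\<lambda>x. \<eta>1 x * E x)"
        by (rule integrable_compactly_supported[where r=2])
           (use 1 in \<open>auto simp: ball_cutoff_def intro!: continuous_intros continuous_E C1_grad_continuous[OF \<eta>1]\<close>)
      show "integrable lborel (\<lambda>x. \<eta> x * E x)"
        by (rule integrable_compactly_supported[where r="2*R"])
           (auto simp: out intro!: continuous_intros continuous_E C1_grad_continuous[OF \<eta>])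
      show "\<eta>1 x * E x \<le> \<eta> x * E x" for x
      proof (rule mult_right_mono[OF _ E_nonneg])
        show "\<eta>1 x \<le> \<eta> x"
          using 1 cut R2 unfolding ball_cutoff_def by (cases "norm x \<le> R") auto
      qed
    qed
    then have "\<delta> * c0 \<le> \<delta> * (LINT x|lborel. \<eta> x * E x)" using \<delta> by simp
    also have "\<dots> = (LINT x|lborel. - (\<Sum>i\<in>UNIV. G x $ i * pohozaev_field i x))"
      unfolding \<delta>_def using pohozaev_identity[OF \<eta> out] by simp
    also have "\<dots> \<le> (LINT x|lborel. K * (N + 3) * A x)"
    proof (rule integral_mono')
      show "integrable lborel (\<lambda>x. K * (N + 3) * A x)" using A(1) by simp
      show "0 \<le> K * (N + 3) * A x" for x using K(1) A(2) N3 by simp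
      show "- (\<Sum>i\<in>UNIV. G x $ i * pohozaev_field i x) \<le> K * (N + 3) * A x" for x
      proof (cases "G x = 0")
        case True
        then show ?thesis using K(1) A(2)[of x] N3 by simp
      next
        case False
        then have x: "R \<le> norm x" "norm x \<le> 2 * R" using cut by (auto simp: ball_cutoff_def)
        have g: "norm (G x) \<le> K / R" using cut by (simp add: ball_cutoff_def)
        let ?n = "(norm (U x))\<^sup>2" and ?v = "(u x)\<^sup>2 / R\<^sup>2"
        have gx: "norm (G x) * norm x \<le> 2 * K"
        proof -
          have "norm (G x) * norm x \<le> K / R * (2 * R)" using g x K(1) R2 by (intro mult_mono) auto
          then show ?thesis using R2 by simp
        qed
        have t1: "- ((x \<bullet> U x) * (G x \<bullet> U x)) \<le> 2 * K * ?n"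
        proof -
          have "- ((x \<bullet> U x) * (G x \<bullet> U x)) \<le> \<bar>x \<bullet> U x\<bar> * \<bar>G x \<bullet> U x\<bar>"
            by (metis abs_ge_minus_self abs_mult)
          also have "\<dots> \<le> (norm x * norm (U x)) * (norm (G x) * norm (U x))"
            by (intro mult_mono Cauchy_Schwarz_ineq2) auto
          also have "\<dots> = norm (G x) * norm x * ?n" by (simp add: power2_eq_square)
          also have "\<dots> \<le> 2 * K * ?n" by (intro mult_right_mono gx) auto
          finally show ?thesis .
        qed
        have Gx: "\<bar>G x \<bullet> x\<bar> \<le> 2 * K" using Cauchy_Schwarz_ineq2[of "G x" x] gx by linarith
        have t2: "(G x \<bullet> x) * (?n / 2) \<le> K * ?n"
          using mult_right_mono[of "G x \<bullet> x" "2 * K" "?n / 2"] Gx by simp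
        have t3: "- ((G x \<bullet> x) * (E x / (p + 1))) \<le> 2 * K * E x"
        proof -
          have "- ((G x \<bullet> x) * (E x / (p + 1))) \<le> 2 * K * (E x / (p + 1))"
            using mult_right_mono[of "- (G x \<bullet> x)" "2 * K" "E x / (p + 1)"] Gx E_nonneg[of x] p by simp
          also have "\<dots> \<le> 2 * K * E x"
            using K(1) E_nonneg[of x] p by (intro mult_left_mono) (simp_all add: divide_le_eq distrib_left)
          finally show ?thesis .
        qed
        have t4: "- (u x * (G x \<bullet> U x)) \<le> K * (?n + ?v)"
        proof -
          have uR: "u x / R * norm (U x) \<le> ?n + ?v"
          proof -
            have "2 * (u x / R * norm (U x)) \<le> ?n + ?v"
              using sum_squares_bound[of "u x / R" "norm (U x)"] by (simp add: power_divide mult.assoc)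
            moreover have "0 \<le> u x / R * norm (U x)" using pos[of x] R2 by simp
            ultimately show ?thesis by linarith
          qed
          have "- (G x \<bullet> U x) \<le> norm (G x) * norm (U x)"
            using Cauchy_Schwarz_ineq2[of "G x" "U x"] by linarith
          also have "\<dots> \<le> K / R * norm (U x)" using g by (intro mult_right_mono) auto
          finally have "u x * - (G x \<bullet> U x) \<le> u x * (K / R * norm (U x))"
            using pos[of x] by (intro mult_left_mono) auto
          also have "\<dots> = K * (u x / R * norm (U x))" by simp
          also have "\<dots> \<le> K * (?n + ?v)" by (intro mult_left_mono uR K(1))
          finally show ?thesis by simp
        qed
        have "(\<Sum>i\<in>UNIV. G x $ i * pohozaev_field i x) = (x \<bullet> U x) * (G x \<bullet> U x) - (G x \<bullet> x) * (?n / 2)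
            + (G x \<bullet> x) * (E x / (p + 1)) + (N - 2) / 2 * (u x * (G x \<bullet> U x))"
        proof -
          have "G x $ i * pohozaev_field i x = (x \<bullet> U x) * (G x $ i * U x $ i) - (?n / 2) * (G x $ i * x $ i)
              + (E x / (p + 1)) * (G x $ i * x $ i) + ((N - 2) / 2 * u x) * (G x $ i * U x $ i)" for i
            unfolding pohozaev_field_def by (simp add: algebra_simps)
          then have "(\<Sum>i\<in>UNIV. G x $ i * pohozaev_field i x)
              = (x \<bullet> U x) * (G x \<bullet> U x) - (?n / 2) * (G x \<bullet> x)
              + (E x / (p + 1)) * (G x \<bullet> x) + ((N - 2) / 2 * u x) * (G x \<bullet> U x)"
            by (simp only: sum.distrib sum_subtractf sum_distrib_left[symmetric] inner_vec_def inner_real_def)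
          then show ?thesis by (simp add: mult_ac)
        qed
        moreover have "- ((N - 2) / 2 * (u x * (G x \<bullet> U x))) \<le> (N - 2) / 2 * (K * (?n + ?v))"
          using mult_left_mono[OF t4, of "(N - 2) / 2"] N3 by simp
        ultimately have "- (\<Sum>i\<in>UNIV. G x $ i * pohozaev_field i x)
            \<le> 2 * K * ?n + K * ?n + 2 * K * E x + (N - 2) / 2 * (K * (?n + ?v))"
          using t1 t2 t3 by linarith
        also have "\<dots> \<le> K * (N + 3) * (E x + ?n + ?v)"
        proof -
          have "K * (N + 3) * (\<epsilon> + n + v) - (2 * K * n + K * n + 2 * K * \<epsilon> + (N - 2) / 2 * (K * (n + v)))
              = K * ((N + 1) * \<epsilon> + (N / 2 + 1) * n + (N / 2 + 4) * v)" for \<epsilon> n v :: real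
            by (simp add: field_simps)
          moreover have "0 \<le> K * ((N + 1) * E x + (N / 2 + 1) * ?n + (N / 2 + 4) * ?v)"
            using K(1) N3 E_nonneg[of x] by (intro mult_nonneg_nonneg add_nonneg_nonneg) auto
          ultimately show ?thesis by (metis diff_ge_0_iff_ge)
        qed
        also have "\<dots> \<le> K * (N + 3) * A x"
          using A(3)[of x] x K(1) N3 by (intro mult_left_mono) auto
        finally show ?thesis .
      qed
    qed
    also have "\<dots> = K * (N + 3) * integral\<^sup>L lborel A" by simp
    also have "\<dots> \<le> K * (N + 3) * (C * R powr e)" using A(4) K(1) N3 by (intro mult_left_mono) auto
    finally show ?thesis by (simp add: mult.assoc)
  qed
  have "((\<lambda>R. K * (N + 3) * C * R powr e) \<longlongrightarrow> 0) at_top"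
    by (intro tendsto_mult_right_zero tendsto_neg_powr e filterlim_ident)
  moreover have "\<forall>\<^sub>F R in at_top. \<delta> * c0 \<le> K * (N + 3) * C * R powr e"
    using eventually_ge_at_top[of "max 2 R0"] by eventually_elim (rule bound)
  ultimately have "\<delta> * c0 \<le> 0" by (intro tendsto_lowerbound) auto
  then show False using \<delta> c0 by (simp add: mult_le_0_iff)
qed

end

lemma henon_solutionI:
  fixes u :: "real ^ 'n::finite \<Rightarrow> real"
  assumes "positive_solution a p u" "a \<ge> 0" "p > 1"
  shows "henon_solution a p (real CARD('n)) u (grad u) (\<lambda>i. grad (partial_deriv i u))"
proof
  have u: "u \<in> C1" "\<And>i. partial_deriv i u \<in> C1" using assms(1) by (auto simp: positive_solution_def C2_def)
  show "C1_grad u (grad u)" by (rule C1_grad_of_C1[OF u(1)])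
  show "C1_grad (\<lambda>x. grad u x $ i) (grad (partial_deriv i u))" for i
    using C1_grad_of_C1[OF u(2)] by (simp add: grad_def)
  show "u x > 0" for x using assms(1) by (simp add: positive_solution_def)
  show "(\<Sum>i\<in>UNIV. grad (partial_deriv i u) x $ i) = - (norm_pow a x * u x powr p)" for x
  proof -
    have "- laplacian u x = norm_pow a x * u x powr p" using assms(1) by (simp add: positive_solution_def)
    then show ?thesis by (simp add: laplacian_def grad_def)
  qed
qed (use assms in auto)

theorem theorem2:
  fixes a p :: real
  assumes "a \<ge> 0" and "p > 1" and "CARD('n::finite) \<ge> 3"
    and "p < (real CARD('n) + 2 + 2 * a) / (real CARD('n) - 2)"
  shows "\<not> (\<exists>u :: real ^ 'n \<Rightarrow> real. positive_solution a p u \<and> finite_morse_index a p u)"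
proof
  assume "\<exists>u :: real ^ 'n \<Rightarrow> real. positive_solution a p u \<and> finite_morse_index a p u"
  then obtain u :: "real ^ 'n \<Rightarrow> real" where u: "positive_solution a p u" "finite_morse_index a p u" by blast
  interpret henon_solution a p "real CARD('n)" u "grad u" "\<lambda>i. grad (partial_deriv i u)"
    by (rule henon_solutionI[OF u(1) assms(1,2)])
  obtain r where "stable_outside a p u r"
    using finite_morse_index_imp_stable_outside[OF assms(1) continuous_u pos u(2)] by blast
  then show False using not_stable_outside assms(3,4) by simp
qed

end
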